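(* Let $k\ge0$ and $n\ge k$ ($n\ge1$) be integers, let $\lambda$ be a $k$-strict partition in $\mathcal P_n^{(k)}$ and $\chi$ the corresponding characteristic index. Then $$\sum_{I\subset D(\lambda)}\mathrm{Pf}\left[{}_k\vartheta_{\lambda_1+a_1^I}^{(\chi_1)}\cdots{}_k\vartheta_{\lambda_{n-k}+a_{n-k}^I}^{(\chi_{n-k})}\right]=R_\lambda\left[{}_k\vartheta_{\lambda_1}^{(\chi_1)}\cdots{}_k\vartheta_{\lambda_{n-k}}^{(\chi_{n-k})}\right],$$ where $I$ runs over all subsets of $D(\lambda)$, $a_s^I=\#\{j\mid(s,j)\in I\}-\#\{i\mid(i,s)\in I\}$, and $$R_\lambda\left[{}_k\vartheta_{\lambda_1}^{(\chi_1)}\cdots{}_k\vartheta_{\lambda_{n-k}}^{(\chi_{n-k})}\right]:=\left.\left(\prod_{(i,j)\in D(\lambda)^c}\frac{1-R_{ij}}{1+R_{ij}}\prod_{(i,j)\in D(\lambda)}(1-R_{ij})\,\bigl(c_{\lambda_1}^{(1)}\cdots c_{\lambda_{n-k}}^{(n-k)}\bigr)\right)\right|_{c_r^{(i)}={}_k\vartheta_r^{(\chi_i)}}$$ with $D(\lambda)^c=\{(i,j)\mid1\le i<j\le n-k\}\setminus D(\lambda)$.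
   Context: **$k$-strict partitions.** A partition is $k$-strict if no part greater than $k$ is repeated. $\mathcal P_n^{(k)}$ is the set of $k$-strict partitions with Young diagram inside the $(n-k)\times(n+k)$ rectangle; $\lambda\in\mathcal P_n^{(k)}$ is written $(\lambda_1,\ldots,\lambda_{n-k})$ with zeros allowed. Such $\lambda$ correspond bijectively to signed permutations of the form $w_\lambda^{(k)}=v_1\cdots v_k|\overline{\zeta_1}\cdots\overline{\zeta_s}u_1\cdots u_{n-k-s}$ (one-line notation, $\bar i=-i$, the $v$'s, $\zeta$'s and $u$'s together being a permutation of $1,\ldots,n$) with $0<v_1<\cdots<v_k$, $\zeta_1>\cdots>\zeta_s>0$, $0<u_1<\cdots<u_{n-k-s}$, via $\lambda_i=\zeta_i+k$ for $1\le i\le s$ and $\lambda_{s+j}=\#\{p\mid v_p>u_j\}$ for $1\le j\le n-k-s$. The characteristic index is $\chi=(\zeta_1-1,\ldots,\zeta_s-1,-u_1,\ldots,-u_{n-k-s})\in\mathbb Z^{n-k}$, and $D(\lambda)=\{(i,j)\mid 1\le i<j\le n-k,\ \chi_i+\chi_j<0\}$. **Theta polynomials.** With $x,z,t$ infinite sequences of variables, for $l\ge0$: $\sum_{r\ge0}{}_k\vartheta_r^{(l)}u^r=\prod_{i\ge1}\frac{1+x_iu}{1-x_iu}\prod_{i=1}^k(1+z_iu)\prod_{i=1}^l(1-t_iu)$ and $\sum_{r\ge0}{}_k\vartheta_r^{(-l)}u^r=\prod_{i\ge1}\frac{1+x_iu}{1-x_iu}\prod_{i=1}^k(1+z_iu)\prod_{i=1}^l\frac1{1+t_iu}$;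 ${}_k\vartheta_r^{(l)}=0$ for $r<0$. **Multi Schur-Pfaffian.** For sequences of variables $c^{(i)}=(c_r^{(i)})_{r\in\mathbb Z}$, $1\le i\le m$: $\mathrm{Pf}[c_r^{(1)}]=c_r^{(1)}$; $\mathrm{Pf}[c_{r_1}^{(1)}c_{r_2}^{(2)}]=c_{r_1}^{(1)}c_{r_2}^{(2)}+2\sum_{s=1}^{r_2}(-1)^sc_{r_1+s}^{(1)}c_{r_2-s}^{(2)}$; for even $m\ge4$, $\mathrm{Pf}[c_{r_1}^{(1)}\cdots c_{r_m}^{(m)}]=\sum_{s=2}^m(-1)^s\mathrm{Pf}[c_{r_1}^{(1)}c_{r_s}^{(s)}]\,\mathrm{Pf}[c_{r_2}^{(2)}\cdots\widehat{c_{r_s}^{(s)}}\cdots c_{r_m}^{(m)}]$; for odd $m\ge3$, $\mathrm{Pf}[c_{r_1}^{(1)}\cdots c_{r_m}^{(m)}]=\sum_{s=1}^m(-1)^{s-1}c_{r_s}^{(s)}\mathrm{Pf}[c_{r_1}^{(1)}\cdots\widehat{c_{r_s}^{(s)}}\cdots c_{r_m}^{(m)}]$. The empty Pfaffian ($m=0$) is $1$. $\mathrm{Pf}[{}_k\vartheta_{r_1}^{(l_1)}\cdots{}_k\vartheta_{r_m}^{(l_m)}]$ is obtained by first expanding and then substituting ${}_k\vartheta_s^{(l_i)}$ for $c_s^{(i)}$. **Raising operators.** For $1\le i<j\le m$, $R_{ij}$ acts on monomials by $R_{ij}(c_{r_1}^{(1)}\cdots c_{r_m}^{(m)})=c_{r_1}^{(1)}\cdots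 c_{r_i+1}^{(i)}\cdots c_{r_j-1}^{(j)}\cdots c_{r_m}^{(m)}$, extended linearly; these operators commute. Rational expressions such as $\frac{1-R_{ij}}{1+R_{ij}}=1+2\sum_{s\ge1}(-1)^sR_{ij}^s$ are expanded as formal power series in the $R_{ij}$; applied to a monomial they give a formal (possibly infinite) $\mathbb Z$-linear combination of monomials $c_{s_1}^{(1)}\cdots c_{s_m}^{(m)}$ with well-defined coefficients, in which only finitely many monomials have all $s_i\ge0$. Since ${}_k\vartheta_r^{(l)}=0$ for $r<0$, the substitution $c_r^{(i)}={}_k\vartheta_r^{(\chi_i)}$ (performed after applying all operators) gives a finite sum. *)

theory Defs
  imports "HOL-Library.Poly_Mapping" "HOL-Computational_Algebra.Formal_Power_Series"
begin

section \<open>Formal power series with integer coefficients in arbitrarily many variables\<close>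

text \<open>
  A monomial in variables of type \<open>'v\<close> is a finitely supported exponent vector
  \<open>'v \<Rightarrow>\<^sub>0 nat\<close>; a series is an arbitrary function from monomials to \<open>int\<close>.
  Polynomials do not suffice here: the coefficients of the infinite product over the variables
  \<open>x\<^sub>i\<close> below are infinite sums of monomials.
\<close>

typedef 'v mfps = "UNIV :: (('v \<Rightarrow>\<^sub>0 nat) \<Rightarrow> int) set"
  morphisms mcoeff Abs_mfps ..

setup_lifting type_definition_mfps

lemma mcoeff_Abs [simp]: "mcoeff (Abs_mfps f) = f"
  by (simp add: Abs_mfps_inverse)

lemma mfps_eqI: "(\<And>m. mcoeff f m = mcoeff g m) \<Longrightarrow> f = g"
  by (metis ext mcoeff_inject)

lemma finite_bounded_monomials:
  assumes "finite A"
  shows "finite {a :: 'v \<Rightarrow>\<^sub>0 nat. Poly_Mapping.keys a \<subseteq> A \<and> (\<forall>x. Poly_Mapping.lookup a x \<le> N)}"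
proof (rule finite_subset)
  let ?F = "{f :: 'v \<Rightarrow> nat. \<forall>x. (x \<in> A \<longrightarrow> f x \<in> {..N}) \<and> (x \<notin> A \<longrightarrow> f x = 0)}"
  show "finite (Poly_Mapping.lookup -` ?F)"
  proof (rule finite_vimageI)
    show "finite ?F"
      by (rule finite_set_of_finite_funs) (use assms in auto)
    show "inj (Poly_Mapping.lookup :: ('v \<Rightarrow>\<^sub>0 nat) \<Rightarrow> _)"
      by (rule injI) (simp add: poly_mapping_eqI)
  qed
  show "{a :: 'v \<Rightarrow>\<^sub>0 nat. Poly_Mapping.keys a \<subseteq> A \<and> (\<forall>x. Poly_Mapping.lookup a x \<le> N)} \<subseteq> Poly_Mapping.lookup -` ?F"
    by (auto simp: in_keys_iff)
qed

lemma finite_monomial_splits: "finite {(a, b). a + b = (m :: 'v \<Rightarrow>\<^sub>0 nat)}"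
proof (rule finite_subset)
  define N where "N = Max (insert 0 (Poly_Mapping.lookup m ` Poly_Mapping.keys m))"
  have N: "Poly_Mapping.lookup m x \<le> N" for x
    by (cases "x \<in> Poly_Mapping.keys m") (auto simp: N_def in_keys_iff intro: Max_ge)
  let ?B = "{a :: 'v \<Rightarrow>\<^sub>0 nat. Poly_Mapping.keys a \<subseteq> Poly_Mapping.keys m \<and> (\<forall>x. Poly_Mapping.lookup a x \<le> N)}"
  have "a \<in> ?B" if "a + b = m" for a b
  proof -
    have "Poly_Mapping.lookup a x \<le> Poly_Mapping.lookup m x" for x
      by (simp add: that[symmetric] lookup_add)
    thus ?thesis
      using N unfolding in_keys_iff subset_iff mem_Collect_eq
      by (metis le_trans le_zero_eq)
  qed
  note B = this
  have "a \<in> ?B \<and> b \<in> ?B" if "a + b = m" for a b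
    using B[of a b] B[of b a] that by (simp only: add.commute)
  thus "{(a, b). a + b = m} \<subseteq> ?B \<times> ?B"
    by blast
  show "finite (?B \<times> ?B)"
    by (intro finite_cartesian_product finite_bounded_monomials) simp_all
qed

instantiation mfps :: (type) comm_ring_1
begin

lift_definition zero_mfps :: "'a mfps" is "\<lambda>_. 0" .
lift_definition one_mfps :: "'a mfps" is "\<lambda>m. if m = 0 then 1 else 0" .
lift_definition plus_mfps :: "'a mfps \<Rightarrow> 'a mfps \<Rightarrow> 'a mfps" is "\<lambda>f g m. f m + g m" .
lift_definition minus_mfps :: "'a mfps \<Rightarrow> 'a mfps \<Rightarrow> 'a mfps" is "\<lambda>f g m. f m - g m" .
lift_definition uminus_mfps :: "'a mfps \<Rightarrow> 'a mfps" is "\<lambda>f m. - f m" .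
lift_definition times_mfps :: "'a mfps \<Rightarrow> 'a mfps \<Rightarrow> 'a mfps" is
  "\<lambda>f g m. \<Sum>(a, b) \<in> {(a, b). a + b = m}. f a * g b" .

instance
proof
  fix f g h :: "'a mfps"
  show "f * g * h = f * (g * h)"
  proof transfer
    fix f g h :: "('a \<Rightarrow>\<^sub>0 nat) \<Rightarrow> int"
    show "(\<lambda>m. \<Sum>(p, c) \<in> {(p, c). p + c = m}. (\<Sum>(a, b) \<in> {(a, b). a + b = p}. f a * g b) * h c)
        = (\<lambda>m. \<Sum>(a, q) \<in> {(a, q). a + q = m}. f a * (\<Sum>(b, c) \<in> {(b, c). b + c = q}. g b * h c))"
      (is "?L = ?R")
    proof
      fix m
      have "?L m = (\<Sum>((p, c), (a, b)) \<in> (SIGMA pc : {(p, c). p + c = m}. {(a, b). a + b = fst pc}). f a * g b * h c)"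
        by (subst sum.Sigma[symmetric])
           (use finite_monomial_splits in \<open>auto simp: case_prod_unfold sum_distrib_right\<close>)
      also have "\<dots> = (\<Sum>((a, q), (b, c)) \<in> (SIGMA aq : {(a, q). a + q = m}. {(b, c). b + c = snd aq}). f a * (g b * h c))"
        by (rule sum.reindex_bij_witness[where
              i = "\<lambda>((a, q), (b, c)). ((a + b, c), (a, b))" and
              j = "\<lambda>((p, c), (a, b)). ((a, b + c), (b, c))"])
           (auto simp: algebra_simps)
      also have "\<dots> = ?R m"
        by (subst sum.Sigma[symmetric])
           (use finite_monomial_splits in \<open>auto simp: case_prod_unfold sum_distrib_left\<close>)
      finally show "?L m = ?R m" .
    qed
  qed
  show "f * g = g * f"
  proof transfer
    fix f g :: "('a \<Rightarrow>\<^sub>0 nat) \<Rightarrow> int"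
    have "(\<Sum>(a, b) \<in> {(a, b). a + b = m}. f a * g b) = (\<Sum>(a, b) \<in> {(a, b). a + b = m}. g a * f b)" for m
      by (rule sum.reindex_bij_witness[where i = prod.swap and j = prod.swap])
         (auto simp: add.commute)
    thus "(\<lambda>m. \<Sum>(a, b) \<in> {(a, b). a + b = m}. f a * g b) = (\<lambda>m. \<Sum>(a, b) \<in> {(a, b). a + b = m}. g a * f b)"
      by blast
  qed
  show "1 * f = f"
  proof transfer
    fix f :: "('a \<Rightarrow>\<^sub>0 nat) \<Rightarrow> int"
    show "(\<lambda>m. \<Sum>(a, b) \<in> {(a, b). a + b = m}. (if a = 0 then 1 else 0) * f b) = f"
    proof
      fix m
      have "(\<Sum>(a, b) \<in> {(a, b). a + b = m}. (if a = 0 then 1 else 0) * f b) = (\<Sum>(a, b) \<in> {(0 :: 'a \<Rightarrow>\<^sub>0 nat, m)}. f b)"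
        by (rule sum.mono_neutral_cong_right[OF finite_monomial_splits]) (auto split: if_splits)
      thus "(\<Sum>(a, b) \<in> {(a, b). a + b = m}. (if a = 0 then 1 else 0) * f b) = f m"
        by simp
    qed
  qed
  show "(f + g) * h = f * h + g * h"
    by transfer (auto simp: algebra_simps sum.distrib case_prod_unfold)
  show "(0 :: 'a mfps) \<noteq> 1"
    by transfer (auto dest: fun_cong[where x = 0])
  show "f + g + h = f + (g + h)" by transfer (simp add: add.assoc)
  show "f + g = g + f" by transfer (simp add: add.commute)
  show "0 + f = f" by transfer simp
  show "- f + f = 0" by transfer simp
  show "f - g = f + - g" by transfer simp
qed

end

lemma mcoeff_simps [simp]:
  "mcoeff 0 m = 0"
  "mcoeff 1 m = (if m = 0 then 1 else 0)"
  "mcoeff (f + g) m = mcoeff f m + mcoeff g m"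
  "mcoeff (f - g) m = mcoeff f m - mcoeff g m"
  "mcoeff (- f) m = - mcoeff f m"
  by (simp_all add: zero_mfps.rep_eq one_mfps.rep_eq plus_mfps.rep_eq minus_mfps.rep_eq uminus_mfps.rep_eq)

lemma mcoeff_times: "mcoeff (f * g) m = (\<Sum>(a, b) \<in> {(a, b). a + b = m}. mcoeff f a * mcoeff g b)"
  by (simp add: times_mfps.rep_eq)

lemma mcoeff_sum: "mcoeff (sum f A) m = (\<Sum>x\<in>A. mcoeff (f x) m)"
  by (induction A rule: infinite_finite_induct) auto

definition mvar :: "'v \<Rightarrow> 'v mfps" where
  "mvar v = Abs_mfps (\<lambda>m. if m = Poly_Mapping.single v 1 then 1 else 0)"

lemma mcoeff_mvar_times_eq_0:
  assumes "Poly_Mapping.lookup m v = 0"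
  shows "mcoeff (mvar v * f) m = 0"
proof -
  have "a \<noteq> Poly_Mapping.single v 1" if "a + b = m" for a b
  proof
    assume "a = Poly_Mapping.single v 1"
    hence "Poly_Mapping.lookup m v = 1 + Poly_Mapping.lookup b v"
      unfolding that[symmetric] lookup_add by simp
    thus False
      using assms by simp
  qed
  thus ?thesis
    unfolding mcoeff_times mvar_def mcoeff_Abs by (intro sum.neutral) auto
qed


lemma mcoeff_mvar_times:
  "mcoeff (mvar v * f) m = (if Poly_Mapping.lookup m v = 0 then 0
     else mcoeff f (m - Poly_Mapping.single v 1))"
proof (cases "Poly_Mapping.lookup m v = 0")
  case True
  thus ?thesis
    by (simp add: mcoeff_mvar_times_eq_0)
next
  case False
  let ?e = "Poly_Mapping.single v (1 :: nat)"
  have m: "?e + (m - ?e) = m"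
    by (rule poly_mapping_eqI) (use False in \<open>auto simp: lookup_add lookup_minus lookup_single when_def\<close>)
  have b: "b = m - ?e" if "?e + b = m" for b
    using that by (metis add_diff_cancel_left')
  have "mcoeff (mvar v * f) m = (\<Sum>(a, b) \<in> {(?e, m - ?e)}. mcoeff (mvar v) a * mcoeff f b)"
    unfolding mcoeff_times
  proof (rule sum.mono_neutral_right[OF finite_monomial_splits])
    show "{(?e, m - ?e)} \<subseteq> {(a, b). a + b = m}"
      using m by simp
    show "\<forall>p \<in> {(a, b). a + b = m} - {(?e, m - ?e)}. (case p of (a, b) \<Rightarrow> mcoeff (mvar v) a * mcoeff f b) = 0"
      using b by (auto simp: mvar_def split: if_splits)
  qed
  thus ?thesis
    using False by (simp add: mvar_def)
qed


section \<open>\<open>k\<close>-strict partitions and the characteristic index\<close>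

text \<open>Lists are indexed from \<open>0\<close>, so \<open>lam ! i\<close> is the part \<open>\<lambda>\<^sub>i\<^sub>+\<^sub>1\<close>, and likewise for
  all sequences and pairs of indices below.\<close>

definition kstrict_partitions :: "nat \<Rightarrow> nat \<Rightarrow> nat list set" where
  "kstrict_partitions n k = {lam. length lam = n - k \<and> sorted_wrt (\<ge>) lam \<and>
     (\<forall>p \<in> set lam. p \<le> n + k) \<and> (\<forall>p > k. count_list lam p \<le> 1)}"

text \<open>The triple \<open>(v, \<zeta>, u)\<close> stands for the signed permutation with one-line notation
  \<open>v\<^sub>1 \<dots> v\<^sub>k (-\<zeta>\<^sub>1) \<dots> (-\<zeta>\<^sub>s) u\<^sub>1 \<dots> u\<^sub>n\<^sub>-\<^sub>k\<^sub>-\<^sub>s\<close>.\<close>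

definition kgrassmannian :: "nat \<Rightarrow> nat \<Rightarrow> (nat list \<times> nat list \<times> nat list) set" where
  "kgrassmannian n k = {(v, \<zeta>, u). length v = k \<and> length \<zeta> + length u = n - k \<and>
     distinct (v @ \<zeta> @ u) \<and> set (v @ \<zeta> @ u) = {1..n} \<and>
     sorted_wrt (<) v \<and> sorted_wrt (>) \<zeta> \<and> sorted_wrt (<) u}"

definition kshape :: "nat \<Rightarrow> nat list \<times> nat list \<times> nat list \<Rightarrow> nat list" where
  "kshape k = (\<lambda>(v, \<zeta>, u). map (\<lambda>z. z + k) \<zeta> @ map (\<lambda>a. length (filter (\<lambda>p. p > a) v)) u)"

lemma kgrassmannianD:
  assumes "(v, \<zeta>, u) \<in> kgrassmannian n k"
  shows "length v = k" "length \<zeta> + length u = n - k" "distinct v" "distinct \<zeta>" "distinct u"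
    "set v \<inter> set u = {}" "set v \<union> set u = {1..n} - set \<zeta>" "set \<zeta> \<subseteq> {1..n}"
    "sorted_wrt (<) v" "sorted_wrt (>) \<zeta>" "sorted_wrt (<) u"
  using assms by (auto simp: kgrassmannian_def)

lemma length_filter_greater_nth:
  fixes xs :: "nat list"
  assumes "sorted_wrt (<) xs" "i < length xs"
  shows "length (filter (\<lambda>p. p > xs ! i) xs) = length xs - Suc i"
proof -
  have "xs = take (Suc i) xs @ drop (Suc i) xs" by simp
  hence "filter (\<lambda>p. p > xs ! i) xs =
      filter (\<lambda>p. p > xs ! i) (take (Suc i) xs) @ filter (\<lambda>p. p > xs ! i) (drop (Suc i) xs)"
    by (metis filter_append)
  also have "filter (\<lambda>p. p > xs ! i) (take (Suc i) xs) = []"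
  proof -
    have "xs ! j \<le> xs ! i" if "j < Suc i" for j
      using assms that by (cases "j = i") (auto simp: sorted_wrt_iff_nth_less less_imp_le)
    thus ?thesis by (auto simp: filter_empty_conv in_set_conv_nth not_less)
  qed
  also have "filter (\<lambda>p. p > xs ! i) (drop (Suc i) xs) = drop (Suc i) xs"
    using assms by (intro filter_True) (auto simp: in_set_conv_nth sorted_wrt_iff_nth_less)
  finally show ?thesis by simp
qed

lemma card_greater_nth:
  fixes u v :: "nat list"
  assumes "distinct v" "distinct u" "set v \<inter> set u = {}" "sorted_wrt (<) u" "j < length u"
  shows "card {a \<in> set v \<union> set u. a > u ! j} =
           length (filter (\<lambda>p. p > u ! j) v) + (length u - Suc j)"
proof -
  have "{a \<in> set v \<union> set u. a > u ! j} = set (filter (\<lambda>p. p > u ! j) v) \<union> set (filter (\<lambda>p. p > u ! j) u)"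
    by auto
  also have "card \<dots> = card (set (filter (\<lambda>p. p > u ! j) v)) + card (set (filter (\<lambda>p. p > u ! j) u))"
    using assms by (intro card_Un_disjoint) auto
  also have "\<dots> = length (filter (\<lambda>p. p > u ! j) v) + length (filter (\<lambda>p. p > u ! j) u)"
    using assms by (simp only: distinct_card distinct_filter)
  finally show ?thesis
    using assms by (simp add: length_filter_greater_nth)
qed

lemma card_greater_inj:
  fixes A :: "nat set"
  assumes "finite A" "a \<in> A" "b \<in> A" "card {x \<in> A. x > a} = card {x \<in> A. x > b}"
  shows "a = b"
proof -
  have *: False if "a < b" "a \<in> A" "b \<in> A" "card {x \<in> A. x > a} = card {x \<in> A. x > b}" for a b
  proof -
    have "{x \<in> A. x > b} \<subset> {x \<in> A. x > a}" using that by auto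
    hence "card {x \<in> A. x > b} < card {x \<in> A. x > a}"
      using assms(1) by (intro psubset_card_mono) auto
    thus False using that by simp
  qed
  show ?thesis
    using *[of a b] *[of b a] assms by (metis linorder_neqE_nat)
qed

lemma count_list_distinct_le: "distinct xs \<Longrightarrow> count_list xs x \<le> 1"
  by (induction xs) (auto simp: count_list_0_iff)

lemma kshape_in:
  assumes w: "(v, \<zeta>, u) \<in> kgrassmannian n k" and "k \<le> n"
  shows "kshape k (v, \<zeta>, u) \<in> kstrict_partitions n k"
proof -
  note D = kgrassmannianD[OF w]
  let ?g = "\<lambda>a. length (filter (\<lambda>p. p > a) v)"
  have g: "?g a \<le> k" for a
    using D(1) length_filter_le[of "\<lambda>p. p > a" v] by simp
  have mono: "?g b \<le> ?g a" if "a < b" for a b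
  proof -
    have "filter (\<lambda>p. p > b) v = filter (\<lambda>p. p > b) (filter (\<lambda>p. p > a) v)"
      using that by (auto intro!: filter_cong)
    thus ?thesis
      by (metis length_filter_le)
  qed
  have s1: "sorted_wrt (\<ge>) (map (\<lambda>z. z + k) \<zeta>)"
    unfolding sorted_wrt_map by (rule sorted_wrt_mono_rel[OF _ D(10)]) simp
  have s2: "sorted_wrt (\<ge>) (map ?g u)"
    unfolding sorted_wrt_map by (rule sorted_wrt_mono_rel[OF _ D(11)]) (simp add: mono)
  have cnt: "count_list (map (\<lambda>z. z + k) \<zeta> @ map ?g u) p \<le> 1" if "p > k" for p
  proof -
    have "p \<notin> set (map ?g u)" using g that by (auto simp: not_le[symmetric])
    moreover have "distinct (map (\<lambda>z. z + k) \<zeta>)" using D(4) by (auto simp: distinct_map)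
    ultimately show ?thesis
      by (simp add: count_list_distinct_le[simplified])
  qed
  have s3: "sorted_wrt (\<ge>) (map (\<lambda>z. z + k) \<zeta> @ map ?g u)"
    unfolding sorted_wrt_append using s1 s2 g by (simp add: trans_le_add2)
  have bound: "p \<le> n + k" if "p \<in> set (map (\<lambda>z. z + k) \<zeta> @ map ?g u)" for p
  proof -
    have "p \<in> (\<lambda>z. z + k) ` set \<zeta> \<or> p \<le> k"
      using that g by auto
    thus ?thesis
      using D(8) by auto
  qed
  show ?thesis
    unfolding kstrict_partitions_def kshape_def prod.case mem_Collect_eq
    by (intro conjI allI impI ballI s3 cnt bound) (simp add: D(2))
qed

lemma kshape_inj:
  assumes w: "(v, \<zeta>, u) \<in> kgrassmannian n k" and w': "(v', \<zeta>', u') \<in> kgrassmannian n k"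
    and eq: "kshape k (v, \<zeta>, u) = kshape k (v', \<zeta>', u')"
  shows "(v, \<zeta>, u) = (v', \<zeta>', u')"
proof -
  have flt: "filter (\<lambda>p. p > k) (kshape k (v, \<zeta>, u)) = map (\<lambda>z. z + k) \<zeta>"
    if "(v, \<zeta>, u) \<in> kgrassmannian n k" for v \<zeta> u
  proof -
    note D = kgrassmannianD[OF that]
    have "filter (\<lambda>p. p > k) (map (\<lambda>z. z + k) \<zeta>) = map (\<lambda>z. z + k) \<zeta>"
      using D(8) by (intro filter_True) auto
    moreover have "filter (\<lambda>p. p > k) (map (\<lambda>a. length (filter (\<lambda>p. p > a) v)) u) = []"
    proof -
      have "length (filter (\<lambda>p. p > a) v) \<le> k" for a
        using D(1) length_filter_le[of "\<lambda>p. p > a" v] by simp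
      thus ?thesis by (auto simp: filter_empty_conv not_less)
    qed
    ultimately show ?thesis by (simp add: kshape_def)
  qed
  note D = kgrassmannianD[OF w] and D' = kgrassmannianD[OF w']
  have "map (\<lambda>z. z + k) \<zeta> = map (\<lambda>z. z + k) \<zeta>'"
    using flt[OF w] flt[OF w'] eq by simp
  hence z: "\<zeta> = \<zeta>'"
    by (rule map_injective) (auto simp: inj_def)
  hence len: "length u = length u'" using D(2) D'(2) by simp
  have g: "map (\<lambda>a. length (filter (\<lambda>p. p > a) v)) u = map (\<lambda>a. length (filter (\<lambda>p. p > a) v')) u'"
    using eq z by (simp add: kshape_def)
  define A where "A = {1..n} - set \<zeta>"
  have A: "set v \<union> set u = A" "set v' \<union> set u' = A"
    using D(7) D'(7) z by (simp_all add: A_def)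
  have u: "u = u'"
  proof (rule nth_equalityI)
    fix j assume j: "j < length u"
    have "length (filter (\<lambda>p. p > u ! j) v) = length (filter (\<lambda>p. p > u' ! j) v')"
      using arg_cong[OF g, of "\<lambda>xs. xs ! j"] j len by simp
    hence "card {a \<in> A. a > u ! j} = card {a \<in> A. a > u' ! j}"
      using card_greater_nth[OF D(3,5,6,11) j] card_greater_nth[OF D'(3,5,6,11), of j] j len A
      by simp
    moreover have "u ! j \<in> A"
      using A(1) j by (metis UnI2 nth_mem)
    moreover have "u' ! j \<in> A"
      using A(2) j len by (metis UnI2 nth_mem)
    moreover have "finite A"
      by (simp add: A_def)
    ultimately show "u ! j = u' ! j"
      by (metis card_greater_inj)
  qed (rule len)
  have "set v = set v'"
    using A D(6) D'(6) u by blast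
  hence "v = v'"
    using D(9) D'(9) by (metis sorted_list_of_set.idem_if_sorted_distinct strict_sorted_iff)
  thus ?thesis using z u by simp
qed

lemma sorted_split_filter:
  fixes xs :: "nat list"
  assumes "sorted_wrt (\<ge>) xs"
  shows "xs = filter (\<lambda>p. p > k) xs @ filter (\<lambda>p. p \<le> k) xs"
  using assms
proof (induction xs)
  case (Cons x xs)
  show ?case
  proof (cases "x > k")
    case True
    thus ?thesis using Cons by simp
  next
    case False
    hence "filter (\<lambda>p. p > k) xs = []" "filter (\<lambda>p. p \<le> k) xs = xs"
      using Cons.prems by (auto simp: filter_empty_conv filter_id_conv intro: order_trans)
    thus ?thesis using False by simp
  qed
qed simp

lemma kshape_surj:
  assumes lam: "lam \<in> kstrict_partitions n k" and "k \<le> n"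
  shows "\<exists>w \<in> kgrassmannian n k. kshape k w = lam"
proof -
  define big where "big = filter (\<lambda>p. p > k) lam"
  define mu where "mu = filter (\<lambda>p. p \<le> k) lam"
  define \<zeta> where "\<zeta> = map (\<lambda>p. p - k) big"
  define A where "A = {1..n} - set \<zeta>"
  define as where "as = sorted_list_of_set A"
  define b where "b = (\<lambda>j. k - mu ! j + j)"
  define u where "u = map (\<lambda>j. as ! b j) [0..<length mu]"
  define v where "v = filter (\<lambda>a. a \<notin> set u) as"
  have P: "length lam = n - k" "sorted_wrt (\<ge>) lam" "\<And>p. p \<in> set lam \<Longrightarrow> p \<le> n + k"
      "\<And>p. p > k \<Longrightarrow> count_list lam p \<le> 1"
    using lam by (auto simp: kstrict_partitions_def)
  have split: "lam = big @ mu"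
    unfolding big_def mu_def by (rule sorted_split_filter[OF P(2)])
  have big: "p > k" if "p \<in> set big" for p using that by (simp add: big_def)
  have mu: "p \<le> k" if "p \<in> set mu" for p using that by (simp add: mu_def)
  have "sorted_wrt (\<ge>) big" and mu_sorted: "sorted_wrt (\<ge>) mu"
    using P(2) unfolding split by (auto simp: sorted_wrt_append)
  have big_sorted: "sorted_wrt (>) big"
    unfolding sorted_wrt_iff_nth_less
  proof (intro allI impI)
    fix i j assume ij: "i < j" "j < length big"
    hence "big ! i \<ge> big ! j"
      using \<open>sorted_wrt (\<ge>) big\<close> by (auto simp: sorted_wrt_iff_nth_less)
    moreover have "big ! i \<noteq> big ! j"
    proof
      assume e: "big ! i = big ! j"
      have "big = take j big @ big ! j # drop (Suc j) big"
        using ij by (simp add: id_take_nth_drop)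
      hence "count_list big (big ! j) = count_list (take j big) (big ! j) + count_list (big ! j # drop (Suc j) big) (big ! j)"
        by (metis count_list_append)
      moreover have "big ! j \<in> set (take j big)"
        using ij e by (metis in_set_conv_nth length_take min.absorb4 nth_take)
      hence "count_list (take j big) (big ! j) \<noteq> 0"
        by (simp add: count_list_0_iff)
      ultimately have "count_list big (big ! j) \<ge> 2" by simp
      moreover have "count_list lam (big ! j) \<le> 1"
        using ij big[of "big ! j"] by (intro P(4)) auto
      ultimately show False by (simp add: split)
    qed
    ultimately show "big ! i > big ! j" by simp
  qed
  have z_sorted: "sorted_wrt (>) \<zeta>"
    unfolding \<zeta>_def sorted_wrt_map
    by (rule sorted_wrt_mono_rel[OF _ big_sorted]) (use big in \<open>auto intro: diff_less_mono less_imp_le\<close>)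
  hence z_dist: "distinct \<zeta>"
    by (auto simp: sorted_wrt_iff_nth_less distinct_conv_nth) (metis less_irrefl_nat linorder_neqE_nat)
  have z_set: "set \<zeta> \<subseteq> {1..n}"
    using big P(3) split by (fastforce simp: \<zeta>_def)
  have len: "length \<zeta> + length mu = n - k"
    using P(1) split by (simp add: \<zeta>_def)
  have finA: "finite A" by (simp add: A_def)
  have as: "set as = A" "sorted_wrt (<) as" "distinct as"
    using finA by (simp_all add: as_def)
  have "card A = n - length \<zeta>"
    using z_set z_dist by (simp add: A_def card_Diff_subset distinct_card)
  hence len_as: "length as = n - length \<zeta>"
    by (simp add: as_def)
  have b_less: "b j < length as" if "j < length mu" for j
    using that len len_as \<open>k \<le> n\<close> by (simp add: b_def)
  have b_mono: "b i < b j" if "i < j" "j < length mu" for i j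
  proof -
    have "mu ! j \<le> mu ! i" using mu_sorted that by (auto simp: sorted_wrt_iff_nth_less)
    thus ?thesis using that by (simp add: b_def)
  qed
  have u_nth: "u ! j = as ! b j" if "j < length mu" for j
    using that by (simp add: u_def)
  have len_u: "length u = length mu" by (simp add: u_def)
  have u_sorted: "sorted_wrt (<) u"
    using b_mono b_less as(2) by (auto simp: sorted_wrt_iff_nth_less u_nth len_u)
  hence u_dist: "distinct u" by (simp add: strict_sorted_iff)
  have u_set: "set u \<subseteq> A"
    using as(1) b_less by (fastforce simp: u_def)
  have v_set: "set v = A - set u" using as(1) by (auto simp: v_def)
  have v_sorted: "sorted_wrt (<) v" using as(2) by (simp add: v_def sorted_wrt_filter)
  hence v_dist: "distinct v" by (simp add: strict_sorted_iff)
  have "length v = card A - length u"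
    using v_dist u_dist u_set v_set finA by (metis card_Diff_subset distinct_card finite_subset)
  hence len_v: "length v = k"
    using \<open>card A = n - length \<zeta>\<close> len len_u \<open>k \<le> n\<close> by simp
  have w: "(v, \<zeta>, u) \<in> kgrassmannian n k"
    using v_set u_set z_set len_v len len_u v_dist u_dist z_dist v_sorted u_sorted z_sorted
    by (auto simp: kgrassmannian_def A_def)
  have "map (\<lambda>a. length (filter (\<lambda>p. p > a) v)) u = mu"
  proof (rule nth_equalityI)
    fix j assume "j < length (map (\<lambda>a. length (filter (\<lambda>p. p > a) v)) u)"
    hence j: "j < length mu" by (simp add: len_u)
    have "set v \<union> set u = set as"
      using v_set u_set as(1) by auto
    hence "card {a \<in> set as. a > u ! j} = length (filter (\<lambda>p. p > u ! j) v) + (length u - Suc j)"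
      using card_greater_nth[OF v_dist u_dist _ u_sorted, of j] v_set j len_u by auto
    moreover have "card {a \<in> set as. a > u ! j} = length (filter (\<lambda>p. p > as ! b j) as)"
      using as(3) by (simp add: u_nth[OF j] distinct_length_filter Int_def conj_commute)
    moreover have "\<dots> = length as - Suc (b j)"
      by (rule length_filter_greater_nth[OF as(2) b_less[OF j]])
    moreover have "mu ! j \<le> k" using j mu by simp
    ultimately have "length (filter (\<lambda>p. p > u ! j) v) = mu ! j"
      using j len len_u len_as \<open>k \<le> n\<close> by (simp add: b_def)
    thus "map (\<lambda>a. length (filter (\<lambda>p. p > a) v)) u ! j = mu ! j"
      using j len_u by simp
  qed (simp add: len_u)
  moreover have "map (\<lambda>z. z + k) \<zeta> = big"
    unfolding \<zeta>_def map_map o_def by (rule map_idI) (use big in force)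
  ultimately have "kshape k (v, \<zeta>, u) = lam"
    by (simp add: kshape_def split)
  thus ?thesis using w by blast
qed

theorem bij_betw_kshape:
  assumes "k \<le> n"
  shows "bij_betw (kshape k) (kgrassmannian n k) (kstrict_partitions n k)"
  unfolding bij_betw_def
proof
  show "inj_on (kshape k) (kgrassmannian n k)"
    by (rule inj_onI) (metis kshape_inj prod_cases3)
  show "kshape k ` kgrassmannian n k = kstrict_partitions n k"
  proof (intro equalityI subsetI)
    fix lam assume "lam \<in> kshape k ` kgrassmannian n k"
    thus "lam \<in> kstrict_partitions n k"
      using kshape_in[OF _ assms] by (metis imageE prod_cases3)
  next
    fix lam assume "lam \<in> kstrict_partitions n k"
    thus "lam \<in> kshape k ` kgrassmannian n k"
      using kshape_surj[OF _ assms] by (metis imageI)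
  qed
qed

definition kperm :: "nat \<Rightarrow> nat \<Rightarrow> nat list \<Rightarrow> nat list \<times> nat list \<times> nat list" where
  "kperm n k lam = the_inv_into (kgrassmannian n k) (kshape k) lam"

definition chi :: "nat \<Rightarrow> nat \<Rightarrow> nat list \<Rightarrow> int list" where
  "chi n k lam = (case kperm n k lam of (v, \<zeta>, u) \<Rightarrow>
     map (\<lambda>z. int z - 1) \<zeta> @ map (\<lambda>a. - int a) u)"

definition index_pairs :: "nat \<Rightarrow> (nat \<times> nat) set" where
  "index_pairs m = {(i, j). i < j \<and> j < m}"

definition D_set :: "nat \<Rightarrow> nat \<Rightarrow> nat list \<Rightarrow> (nat \<times> nat) set" where
  "D_set n k lam = {(i, j) \<in> index_pairs (n - k). chi n k lam ! i + chi n k lam ! j < 0}"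


section \<open>Theta polynomials\<close>

text \<open>The variables \<open>x\<^sub>i, z\<^sub>i, t\<^sub>i\<close> with \<open>i \<ge> 1\<close>; the constructors at \<open>0\<close> are not used.\<close>

datatype xzt = X nat | Z nat | T nat

text \<open>For \<open>f\<close> with constant coefficient \<open>1\<close>, \<open>fps_right_inverse f 1\<close> is \<open>1 / f\<close>
  (the class-based \<open>inverse\<close> on \<open>fps\<close> needs a division on the coefficient ring).\<close>

lemma fps_right_inverse_one:
  assumes "fps_nth f 0 = (1 :: 'a :: comm_ring_1)"
  shows "f * fps_right_inverse f 1 = 1"
  by (rule fps_right_inverse) (use assms in simp)

definition xfactor :: "nat \<Rightarrow> xzt mfps fps" where
  "xfactor i = (1 + fps_const (mvar (X i)) * fps_X) *
     fps_right_inverse (1 - fps_const (mvar (X i)) * fps_X) 1"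

text \<open>The infinite product of the \<open>xfactor i\<close>, \<open>i \<ge> 1\<close>: the limit of the finite products,
  taken coefficient by coefficient. By \<open>xproduct_stable\<close> each coefficient sequence is
  eventually constant.\<close>

definition xproduct :: "xzt mfps fps" where
  "xproduct = Abs_fps (\<lambda>r. Abs_mfps (\<lambda>m.
     lim (\<lambda>N. mcoeff (fps_nth (\<Prod>i = 1..N. xfactor i) r) m)))"

lemma xfactor_eq: "\<exists>G. xfactor i = 1 + fps_const (mvar (X i)) * G"
proof -
  define a where "a = fps_const (mvar (X i)) * (fps_X :: xzt mfps fps)"
  define h where "h = fps_right_inverse (1 - a) 1"
  have "(1 - a) * h = 1"
    unfolding h_def by (rule fps_right_inverse_one) (simp add: a_def)
  hence "(1 + a) * h = 1 + 2 * a * h"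
    by (simp add: algebra_simps)
  thus ?thesis
    unfolding xfactor_def h_def a_def
    by (intro exI[of _ "2 * fps_X * fps_right_inverse (1 - fps_const (mvar (X i)) * fps_X) 1"])
       (simp add: algebra_simps)
qed

lemma xproduct_stable:
  "\<exists>N0. \<forall>N \<ge> N0. mcoeff (fps_nth (\<Prod>i = 1..N. xfactor i) r) m = mcoeff (fps_nth xproduct r) m"
proof -
  define p where "p = (\<lambda>N. mcoeff (fps_nth (\<Prod>i = 1..N. xfactor i) r) m)"
  have "finite {i. X i \<in> Poly_Mapping.keys m}"
    by (rule finite_vimageI[of "Poly_Mapping.keys m" X, unfolded vimage_def])
       (auto simp: inj_def)
  then obtain N0 where N0: "\<And>i. X i \<in> Poly_Mapping.keys m \<Longrightarrow> i \<le> N0"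
    by (auto simp: finite_nat_set_iff_bounded_le)
  have step: "p (Suc N) = p N" if N: "N0 \<le> N" for N
  proof -
    obtain G where G: "xfactor (Suc N) = 1 + fps_const (mvar (X (Suc N))) * G"
      using xfactor_eq by blast
    have "X (Suc N) \<notin> Poly_Mapping.keys m"
      using N0[of "Suc N"] N by auto
    hence z: "Poly_Mapping.lookup m (X (Suc N)) = 0"
      by (simp add: in_keys_iff)
    have "(\<Prod>i = 1..Suc N. xfactor i) =
        (\<Prod>i = 1..N. xfactor i) + fps_const (mvar (X (Suc N))) * (G * (\<Prod>i = 1..N. xfactor i))"
      by (simp add: G algebra_simps)
    thus ?thesis
      unfolding p_def by (simp add: mcoeff_mvar_times_eq_0[OF z] del: prod.cl_ivl_Suc)
  qed
  have const: "p N = p N0" if "N0 \<le> N" for N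
    using that by (induction rule: dec_induct) (simp_all add: step)
  hence "p \<longlonglongrightarrow> p N0"
    by (intro tendsto_eventually eventually_sequentiallyI[of N0])
  hence "lim p = p N0"
    by (rule limI)
  hence "mcoeff (fps_nth xproduct r) m = p N0"
    by (simp add: xproduct_def p_def)
  hence "\<forall>N \<ge> N0. p N = mcoeff (fps_nth xproduct r) m"
    using const by metis
  thus ?thesis
    unfolding p_def by (rule exI[of _ N0])
qed

definition theta_series :: "nat \<Rightarrow> int \<Rightarrow> xzt mfps fps" where
  "theta_series k l = xproduct * (\<Prod>i = 1..k. 1 + fps_const (mvar (Z i)) * fps_X) *
     (if l \<ge> 0 then (\<Prod>i = 1..nat l. 1 - fps_const (mvar (T i)) * fps_X)
      else (\<Prod>i = 1..nat (- l). fps_right_inverse (1 + fps_const (mvar (T i)) * fps_X) 1))"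

definition theta :: "nat \<Rightarrow> int \<Rightarrow> int \<Rightarrow> xzt mfps" where
  "theta k l r = (if r < 0 then 0 else fps_nth (theta_series k l) (nat r))"


section \<open>Multi Schur-Pfaffians\<close>

text \<open>The argument \<open>[(c\<^sub>1, r\<^sub>1), \<dots>, (c\<^sub>m, r\<^sub>m)]\<close> stands for the \<open>m\<close> sequences together with the
  subscripts at which they are taken. The recursion is stated in an arbitrary commutative ring; it
  commutes with ring homomorphisms (\<open>multi_pf_hom\<close>), so applying it to sequences of ring
  elements is the same as expanding it in independent variables and substituting afterwards.
  The subscripts \<open>s\<close> count from \<open>1\<close>, hence \<open>ps ! (s - 1)\<close>.\<close>

definition del_nth :: "nat \<Rightarrow> 'b list \<Rightarrow> 'b list" where
  "del_nth i ps = take i ps @ drop (Suc i) ps"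

lemma length_del_nth: "i < length ps \<Longrightarrow> length (del_nth i ps) = length ps - 1"
  by (simp add: del_nth_def)

function multi_pf :: "((int \<Rightarrow> 'a :: comm_ring_1) \<times> int) list \<Rightarrow> 'a" where
  "multi_pf [] = 1"
| "multi_pf [(c, r)] = c r"
| "multi_pf [(c, r), (d, q)] =
     c r * d q + 2 * (\<Sum>s = 1..nat q. (- 1) ^ s * c (r + int s) * d (q - int s))"
| "multi_pf (p1 # p2 # p3 # ps') = (let ps = p1 # p2 # p3 # ps'; m = length ps in
     if even m
     then (\<Sum>s = 2..m. (- 1) ^ s * multi_pf [p1, ps ! (s - 1)] * multi_pf (tl (del_nth (s - 1) ps)))
     else (\<Sum>s = 1..m. (- 1) ^ (s - 1) * (case ps ! (s - 1) of (c, r) \<Rightarrow> c r) *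
             multi_pf (del_nth (s - 1) ps)))"
  by pat_completeness auto
termination
  by (relation "measure length") (auto simp: length_del_nth)


lemma multi_pf_rec:
  assumes "length ps \<ge> 3"
  shows "multi_pf ps = (if even (length ps)
     then (\<Sum>s = 2..length ps. (- 1) ^ s * multi_pf [hd ps, ps ! (s - 1)] * multi_pf (tl (del_nth (s - 1) ps)))
     else (\<Sum>s = 1..length ps. (- 1) ^ (s - 1) * (case ps ! (s - 1) of (c, r) \<Rightarrow> c r) *
             multi_pf (del_nth (s - 1) ps)))"
proof -
  obtain q1 qs1 where 1: "ps = q1 # qs1" using assms by (cases ps) auto
  obtain q2 qs2 where 2: "qs1 = q2 # qs2" using assms 1 by (cases qs1) auto
  obtain q3 qs3 where 3: "qs2 = q3 # qs3" using assms 1 2 by (cases qs2) auto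
  show ?thesis
    unfolding 1 2 3 by (simp only: multi_pf.simps(4) Let_def list.sel)
qed

lemma multi_pf_hom:
  fixes h :: "'a :: comm_ring_1 \<Rightarrow> 'b :: comm_ring_1"
  assumes add: "\<And>x y. h (x + y) = h x + h y" and mult: "\<And>x y. h (x * y) = h x * h y"
    and one: "h 1 = 1"
  shows "h (multi_pf ps) = multi_pf (map (\<lambda>(c, r). (h \<circ> c, r)) ps)"
proof -
  have zero: "h 0 = 0"
    using add[of 0 0] by simp
  have neg: "h (- x) = - h x" for x
    using add[of x "- x"] by (simp add: zero eq_neg_iff_add_eq_0 add.commute)
  have sum: "h (sum f A) = (\<Sum>x\<in>A. h (f x))" for f and A :: "nat set"
    by (induction A rule: infinite_finite_induct) (auto simp: zero add)
  have pow: "h ((- 1) ^ j) = (- 1) ^ j" for j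
    by (induction j) (auto simp: one neg mult)
  have two: "h 2 = 2"
    using add[of 1 1] by (simp add: one)
  show ?thesis
  proof (induction ps rule: multi_pf.induct)
    case (4 p1 p2 p3 ps')
    define F where "F = (\<lambda>(c :: int \<Rightarrow> 'a, r :: int). (h \<circ> c, r))"
    define ps where "ps = p1 # p2 # p3 # ps'"
    have F_nth: "F (ps ! (s - 1)) = map F ps ! (s - 1)" if "s \<in> {1..length ps}" for s
      using that by (auto simp: nth_map)
    have F_del: "map F (del_nth i ps) = del_nth i (map F ps)" for i
      by (simp add: del_nth_def take_map drop_map)
    have eval: "h (case p of (c, r) \<Rightarrow> c r) = (case F p of (c, r) \<Rightarrow> c r)" for p
      by (simp add: F_def case_prod_unfold)
    have len: "3 \<le> length ps" "3 \<le> length (map F ps)" and hd: "hd ps = p1" "hd (map F ps) = F p1"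
      by (simp_all add: ps_def)
    note rec = multi_pf_rec[OF len(1), unfolded hd] multi_pf_rec[OF len(2), unfolded hd length_map]
    note IH = 4[OF ps_def refl, folded F_def]
    have "h (multi_pf ps) = multi_pf (map F ps)"
    proof (cases "even (length ps)")
      case True
      have "h (multi_pf ps) = (\<Sum>s = 2..length ps.
          (- 1) ^ s * h (multi_pf [p1, ps ! (s - 1)]) * h (multi_pf (tl (del_nth (s - 1) ps))))"
        by (simp only: rec True if_True if_False sum mult pow)
      also have "\<dots> = (\<Sum>s = 2..length ps.
          (- 1) ^ s * multi_pf [F p1, map F ps ! (s - 1)] * multi_pf (tl (del_nth (s - 1) (map F ps))))"
      proof (intro sum.cong refl, goal_cases)
        case (1 s)
        hence s: "s \<in> {1..length ps}" by simp
        show ?case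
          using IH(1)[OF True 1] IH(2)[OF True 1]
          by (simp only: F_nth[OF s] map_tl F_del list.map)
      qed
      also have "\<dots> = multi_pf (map F ps)"
        by (simp only: rec True if_True)
      finally show ?thesis .
    next
      case False
      have "h (multi_pf ps) = (\<Sum>s = 1..length ps.
          (- 1) ^ (s - 1) * h (case ps ! (s - 1) of (c, r) \<Rightarrow> c r) * h (multi_pf (del_nth (s - 1) ps)))"
        by (simp only: rec False if_True if_False sum mult pow)
      also have "\<dots> = (\<Sum>s = 1..length ps.
          (- 1) ^ (s - 1) * (case map F ps ! (s - 1) of (c, r) \<Rightarrow> c r) * multi_pf (del_nth (s - 1) (map F ps)))"
      proof (intro sum.cong refl, goal_cases)
        case (1 s)
        thus ?case
          using IH(3)[OF False 1]
          by (simp only: eval F_nth F_del)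
      qed
      also have "\<dots> = multi_pf (map F ps)"
        by (simp only: rec False if_False)
      finally show ?thesis .
    qed
    thus ?case
      unfolding ps_def F_def .
  qed (simp_all add: one add mult sum pow two)
qed


section \<open>Raising operators\<close>

text \<open>\<open>(nat \<times> nat) mfps\<close> is the ring of formal power series in the operators \<open>R\<^sub>i\<^sub>j\<close>, regarded as
  commuting variables. Here is the expansion of \<open>(1 - R\<^sub>v) / (1 + R\<^sub>v)\<close>.\<close>

definition R_quotient :: "(nat \<times> nat) \<Rightarrow> (nat \<times> nat) mfps" where
  "R_quotient v = Abs_mfps (\<lambda>e. if e = 0 then 1
     else if Poly_Mapping.keys e = {v} then 2 * (- 1) ^ Poly_Mapping.lookup e v else 0)"

lemma R_quotient_eq: "(1 + mvar v) * R_quotient v = 1 - mvar v"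
proof (rule mfps_eqI)
  fix m :: "nat \<times> nat \<Rightarrow>\<^sub>0 nat"
  define q where "q = Poly_Mapping.lookup m v"
  let ?e = "Poly_Mapping.single v (1 :: nat)"
  have key: "m = Poly_Mapping.single v q" if "Poly_Mapping.keys m \<subseteq> {v}"
    by (rule poly_mapping_eqI) (use that in \<open>auto simp: q_def lookup_single when_def in_keys_iff\<close>)
  have L: "mcoeff ((1 + mvar v) * R_quotient v) m =
     mcoeff (R_quotient v) m + (if q = 0 then 0 else mcoeff (R_quotient v) (m - ?e))"
    by (simp add: distrib_right mcoeff_mvar_times q_def)
  show "mcoeff ((1 + mvar v) * R_quotient v) m = mcoeff (1 - mvar v) m"
  proof (cases "Poly_Mapping.keys m \<subseteq> {v}")
    case True
    have m: "m = Poly_Mapping.single v q" by (rule key[OF True])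
    have m': "m - ?e = Poly_Mapping.single v (q - 1)"
      unfolding m by (simp add: single_diff)
    have Z: "Poly_Mapping.single v p = 0 \<longleftrightarrow> p = 0" for p :: nat
      by (metis lookup_single_eq lookup_zero single_zero)
    have S: "mcoeff (R_quotient v) (Poly_Mapping.single v p) = (if p = 0 then 1 else 2 * (- 1) ^ p)" for p
      by (simp add: R_quotient_def Z)
    have E: "Poly_Mapping.single v p = Poly_Mapping.single v p' \<longleftrightarrow> p = p'" for p p' :: nat
      by (metis lookup_single_eq)
    show ?thesis
      unfolding L m' unfolding m S by (cases q) (auto simp: mvar_def E Z simp flip: One_nat_def)
  next
    case False
    then obtain w where w: "w \<in> Poly_Mapping.keys m" "w \<noteq> v" by blast
    hence "w \<in> Poly_Mapping.keys (m - ?e)"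
      by (auto simp: in_keys_iff lookup_minus lookup_single when_def)
    hence "m - ?e \<noteq> 0" "Poly_Mapping.keys (m - ?e) \<noteq> {v}" "m \<noteq> 0" "Poly_Mapping.keys m \<noteq> {v}" "m \<noteq> ?e"
      using w by auto
    thus ?thesis
      unfolding L by (simp add: R_quotient_def mvar_def)
  qed
qed

definition R_operator :: "nat \<Rightarrow> (nat \<times> nat) set \<Rightarrow> (nat \<times> nat) mfps" where
  "R_operator m D = (\<Prod>p \<in> index_pairs m - D. R_quotient p) * (\<Prod>p \<in> D. 1 - mvar p)"

text \<open>A monomial \<open>c\<^sup>(\<^sup>1\<^sup>) \<dots> c\<^sup>(\<^sup>m\<^sup>)\<close> is given by the list of its \<open>m\<close> subscripts, and a formal infinite
  linear combination of monomials by its coefficient function \<open>int list \<Rightarrow> int\<close>. The product of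
  the operators \<open>R\<^sub>i\<^sub>j\<close> with multiplicities \<open>e (i, j)\<close> raises the \<open>i\<close>-th subscript by the number
  of operators with first index \<open>i\<close> and lowers it by the number of those with second index \<open>i\<close>.\<close>

definition raise :: "(nat \<times> nat \<Rightarrow>\<^sub>0 nat) \<Rightarrow> int list \<Rightarrow> int list" where
  "raise e s = map (\<lambda>i. s ! i + (\<Sum>j < length s. int (Poly_Mapping.lookup e (i, j)))
                             - (\<Sum>j < length s. int (Poly_Mapping.lookup e (j, i)))) [0..<length s]"

definition apply_series :: "(nat \<times> nat) mfps \<Rightarrow> int list \<Rightarrow> (int list \<Rightarrow> int)" where
  "apply_series Q s = (\<lambda>s'. \<Sum>e \<in> {e. mcoeff Q e \<noteq> 0 \<and> raise e s = s'}. mcoeff Q e)"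

lemma raise_zero: "raise 0 s = s"
  by (simp add: raise_def map_nth)

lemma raise_add: "raise (e + f) s = raise e (raise f s)"
  by (rule nth_equalityI) (simp_all add: raise_def lookup_add sum.distrib)

lemma raise_single:
  assumes "i \<noteq> j" "i < length s" "j < length s"
  shows "raise (Poly_Mapping.single (i, j) 1) s = s[i := s ! i + 1, j := s ! j - 1]"
proof (rule nth_equalityI)
  fix l assume "l < length (raise (Poly_Mapping.single (i, j) 1) s)"
  hence l: "l < length s" by (simp add: raise_def)
  have "(\<Sum>q < length s. int (Poly_Mapping.lookup (Poly_Mapping.single (i, j) 1) (l, q))) =
      (\<Sum>q < length s. if q = j then (if l = i then 1 else 0) else 0)"
    by (intro sum.cong) (auto simp: lookup_single when_def)
  hence 1: "(\<Sum>q < length s. int (Poly_Mapping.lookup (Poly_Mapping.single (i, j) 1) (l, q))) =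
      (if l = i then 1 else 0)"
    using assms by simp
  have "(\<Sum>q < length s. int (Poly_Mapping.lookup (Poly_Mapping.single (i, j) 1) (q, l))) =
      (\<Sum>q < length s. if q = i then (if l = j then 1 else 0) else 0)"
    by (intro sum.cong) (auto simp: lookup_single when_def)
  hence 2: "(\<Sum>q < length s. int (Poly_Mapping.lookup (Poly_Mapping.single (i, j) 1) (q, l))) =
      (if l = j then 1 else 0)"
    using assms by simp
  show "raise (Poly_Mapping.single (i, j) 1) s ! l = s[i := s ! i + 1, j := s ! j - 1] ! l"
    unfolding raise_def using l assms by (simp add: 1[simplified] 2[simplified] nth_list_update)
qed (simp add: raise_def)

text \<open>An operator \<open>R\<^sub>i\<^sub>j\<close> with \<open>i < j\<close> decreases \<open>\<Sum>i. i * s ! i\<close>, so boundedness of this weight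
  from below bounds the number of operators.\<close>

lemma raise_weight:
  assumes keys: "Poly_Mapping.keys e \<subseteq> index_pairs (length s)"
  shows "(\<Sum>i < length s. int i * raise e s ! i) + int (Poly_Mapping.lookup e p) \<le> (\<Sum>i < length s. int i * s ! i)"
proof -
  let ?m = "length s"
  define L where "L = (\<lambda>i j. int (Poly_Mapping.lookup e (i, j)))"
  have "(\<Sum>i < ?m. int i * raise e s ! i) =
      (\<Sum>i < ?m. int i * s ! i + int i * (\<Sum>j < ?m. L i j) - int i * (\<Sum>j < ?m. L j i))"
    by (simp add: raise_def L_def algebra_simps)
  also have "\<dots> = (\<Sum>i < ?m. int i * s ! i) + (\<Sum>i < ?m. \<Sum>j < ?m. int i * L i j) - (\<Sum>i < ?m. \<Sum>j < ?m. int i * L j i)"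
    by (simp add: sum.distrib sum_subtractf sum_distrib_left)
  also have "(\<Sum>i < ?m. \<Sum>j < ?m. int i * L j i) = (\<Sum>i < ?m. \<Sum>j < ?m. int j * L i j)"
    by (rule sum.swap)
  finally have eq: "(\<Sum>i < ?m. int i * raise e s ! i) =
      (\<Sum>i < ?m. int i * s ! i) - (\<Sum>i < ?m. \<Sum>j < ?m. (int j - int i) * L i j)"
    by (simp add: sum_subtractf left_diff_distrib)
  have nn: "(int j - int i) * L i j \<ge> L i j" for i j
  proof (cases "(i, j) \<in> Poly_Mapping.keys e")
    case True
    hence "i < j" using keys by (auto simp: index_pairs_def)
    thus ?thesis
      using mult_right_mono[of 1 "int j - int i" "L i j"] by (simp add: L_def)
  next
    case False
    thus ?thesis by (simp add: L_def in_keys_iff)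
  qed
  have "L i j \<ge> 0" for i j by (simp add: L_def)
  hence L0: "(int j - int i) * L i j \<ge> 0" for i j
    using nn order_trans by blast
  have "int (Poly_Mapping.lookup e p) \<le> (\<Sum>i < ?m. \<Sum>j < ?m. (int j - int i) * L i j)"
  proof (cases "p \<in> Poly_Mapping.keys e")
    case True
    obtain i j where p: "p = (i, j)" by force
    have ij: "i < ?m" "j < ?m"
      using True keys by (auto simp: p index_pairs_def)
    have "L i j \<le> (int j - int i) * L i j" by (rule nn)
    also have "\<dots> \<le> (\<Sum>j < ?m. (int j - int i) * L i j)"
      using ij nn L0 by (intro member_le_sum)  auto
    also have "\<dots> \<le> (\<Sum>i < ?m. \<Sum>j < ?m. (int j - int i) * L i j)"
      using ij nn L0 by (intro member_le_sum[of i _ "\<lambda>i. \<Sum>j < ?m. (int j - int i) * L i j"] sum_nonneg)  auto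
    finally show ?thesis by (simp add: p L_def)
  next
    case False
    have "0 \<le> (\<Sum>i < ?m. \<Sum>j < ?m. (int j - int i) * L i j)"
      using nn L0 by (intro sum_nonneg)  auto
    thus ?thesis using False by (simp add: in_keys_iff)
  qed
  thus ?thesis unfolding eq by simp
qed

lemma finite_index_pairs: "finite (index_pairs m)"
  by (rule finite_subset[of _ "{..<m} \<times> {..<m}"]) (auto simp: index_pairs_def)

lemma finite_raise_weight:
  "finite {e. Poly_Mapping.keys e \<subseteq> index_pairs (length s) \<and> W \<le> (\<Sum>i < length s. int i * raise e s ! i)}"
proof (rule finite_subset)
  let ?N = "nat ((\<Sum>i < length s. int i * s ! i) - W)"
  show "{e. Poly_Mapping.keys e \<subseteq> index_pairs (length s) \<and> W \<le> (\<Sum>i < length s. int i * raise e s ! i)}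
      \<subseteq> {e. Poly_Mapping.keys e \<subseteq> index_pairs (length s) \<and> (\<forall>p. Poly_Mapping.lookup e p \<le> ?N)}"
  proof (intro Collect_mono impI conjI allI; elim conjE)
    fix e p assume "Poly_Mapping.keys e \<subseteq> index_pairs (length s)" "W \<le> (\<Sum>i < length s. int i * raise e s ! i)"
    thus "Poly_Mapping.lookup e p \<le> ?N"
      using raise_weight[of e s p] by linarith
  qed
qed (intro finite_bounded_monomials finite_index_pairs)

text \<open>The coefficients of \<open>apply_series\<close> are finite sums.\<close>

lemma finite_raise_fibre:
  "finite {e. Poly_Mapping.keys e \<subseteq> index_pairs (length s) \<and> raise e s = s'}"
  by (rule finite_subset[OF _ finite_raise_weight[of s "\<Sum>i < length s. int i * s' ! i"]]) auto

definition mfps_in :: "'v set \<Rightarrow> 'v mfps \<Rightarrow> bool" where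
  "mfps_in V f \<longleftrightarrow> (\<forall>m. mcoeff f m \<noteq> 0 \<longrightarrow> Poly_Mapping.keys m \<subseteq> V)"

lemma mfps_in_times: "mfps_in V f \<Longrightarrow> mfps_in V g \<Longrightarrow> mfps_in V (f * g)"
  unfolding mfps_in_def mcoeff_times
proof (intro allI impI)
  fix m
  assume f: "\<forall>m. mcoeff f m \<noteq> 0 \<longrightarrow> Poly_Mapping.keys m \<subseteq> V"
    and g: "\<forall>m. mcoeff g m \<noteq> 0 \<longrightarrow> Poly_Mapping.keys m \<subseteq> V"
    and "(\<Sum>(a, b) \<in> {(a, b). a + b = m}. mcoeff f a * mcoeff g b) \<noteq> 0"
  then obtain p where "p \<in> {(a, b). a + b = m}" "(case p of (a, b) \<Rightarrow> mcoeff f a * mcoeff g b) \<noteq> 0"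
    by (blast elim: sum.not_neutral_contains_not_neutral)
  then obtain a b where "a + b = m" "mcoeff f a \<noteq> 0" "mcoeff g b \<noteq> 0"
    by auto
  thus "Poly_Mapping.keys m \<subseteq> V"
    using f g Poly_Mapping.keys_add[of a b] by blast
qed

lemma mfps_in_prod: "(\<And>x. x \<in> A \<Longrightarrow> mfps_in V (f x)) \<Longrightarrow> mfps_in V (prod f A)"
  by (induction A rule: infinite_finite_induct) (auto simp: mfps_in_times, auto simp: mfps_in_def)

lemma mfps_in_R_operator:
  assumes "D \<subseteq> index_pairs m"
  shows "mfps_in (index_pairs m) (R_operator m D)"
  unfolding R_operator_def
proof (intro mfps_in_times mfps_in_prod)
  fix p assume "p \<in> index_pairs m - D"
  thus "mfps_in (index_pairs m) (R_quotient p)"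
    by (auto simp: mfps_in_def R_quotient_def split: if_splits)
next
  fix p assume "p \<in> D"
  thus "mfps_in (index_pairs m) (1 - mvar p)"
    using assms by (auto simp: mfps_in_def mvar_def split: if_splits)
qed

lemma finite_support_substitute:
  fixes c :: "nat \<Rightarrow> int \<Rightarrow> 'a :: comm_ring_1"
  assumes Q: "mfps_in (index_pairs (length s)) Q" and c: "\<And>i r. r < 0 \<Longrightarrow> c i r = 0"
  shows "finite {s'. of_int (apply_series Q s s') * (\<Prod>i < length s'. c i (s' ! i)) \<noteq> 0}"
proof (rule finite_subset)
  let ?E = "{e. Poly_Mapping.keys e \<subseteq> index_pairs (length s) \<and> 0 \<le> (\<Sum>i < length s. int i * raise e s ! i)}"
  show "finite ((\<lambda>e. raise e s) ` ?E)"
    by (intro finite_imageI finite_raise_weight)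
  show "{s'. of_int (apply_series Q s s') * (\<Prod>i < length s'. c i (s' ! i)) \<noteq> 0} \<subseteq> (\<lambda>e. raise e s) ` ?E"
  proof
    fix s' assume "s' \<in> {s'. of_int (apply_series Q s s') * (\<Prod>i < length s'. c i (s' ! i)) \<noteq> 0}"
    hence "apply_series Q s s' \<noteq> 0" and P: "(\<Prod>i < length s'. c i (s' ! i)) \<noteq> 0"
      by auto
    then obtain e where e: "mcoeff Q e \<noteq> 0" "raise e s = s'"
      unfolding apply_series_def by (auto elim: sum.not_neutral_contains_not_neutral)
    have len: "length s' = length s"
      using e(2) by (auto simp: raise_def)
    have "s' ! i \<ge> 0" if "i < length s'" for i
    proof (rule ccontr)
      assume "\<not> s' ! i \<ge> 0"
      hence "(\<Prod>i < length s'. c i (s' ! i)) = 0"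
        using that c[of "s' ! i" i] by (intro prod_zero) (auto simp: not_le)
      thus False using P by simp
    qed
    hence "0 \<le> (\<Sum>i < length s. int i * raise e s ! i)"
      using len e(2) by (intro sum_nonneg) auto
    thus "s' \<in> (\<lambda>e. raise e s) ` ?E"
      using e Q by (auto simp: mfps_in_def)
  qed
qed

text \<open>\<open>Sum_any\<close> adds up the nonzero terms, of which there are only finitely many in the
  present situation; see \<open>finite_support_substitute\<close>.\<close>

definition substitute :: "(nat \<Rightarrow> int \<Rightarrow> 'a :: comm_ring_1) \<Rightarrow> (int list \<Rightarrow> int) \<Rightarrow> 'a" where
  "substitute c F = Sum_any (\<lambda>s. of_int (F s) * (\<Prod>i < length s. c i (s ! i)))"

definition R_theta :: "nat \<Rightarrow> nat \<Rightarrow> nat list \<Rightarrow> xzt mfps" where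
  "R_theta n k lam = substitute (\<lambda>i. theta k (chi n k lam ! i))
     (apply_series (R_operator (n - k) (D_set n k lam)) (map int lam))"

definition a_shift :: "(nat \<times> nat) set \<Rightarrow> nat \<Rightarrow> int" where
  "a_shift I s = int (card {j. (s, j) \<in> I}) - int (card {i. (i, s) \<in> I})"

end

theory Submission
  imports Defs
begin

text \<open>
  Write \<open>q\<^sub>i\<^sub>j\<close> for \<open>(1 - R\<^sub>i\<^sub>j) / (1 + R\<^sub>i\<^sub>j)\<close>. The shifts by \<open>a_shift I\<close> are the effect of the monomial
  \<open>\<Prod>(i, j) \<in> I. R\<^sub>i\<^sub>j\<close>, and the sum of these monomials over all \<open>I \<subseteq> D\<close> is
  \<open>\<Prod>(i, j) \<in> D. (1 + R\<^sub>i\<^sub>j)\<close>. Hence, once the multi Schur-Pfaffian is known to be the value of the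
  product of all \<open>q\<^sub>i\<^sub>j\<close>, the left-hand side is the value of
  \<open>\<Prod>\<^sub>D (1 + R\<^sub>i\<^sub>j) * \<Prod>\<^sub>i\<^sub><\<^sub>j q\<^sub>i\<^sub>j\<close>, and the factors with index in \<open>D\<close> combine to \<open>1 - R\<^sub>i\<^sub>j\<close>. This
  argument works for every set \<open>D\<close> of index pairs and all sequences that vanish at negative
  subscripts (\<open>sum_multi_pf_eq_substitute_R_operator\<close>).

  That the Pfaffian is the value of \<open>\<Prod>\<^sub>i\<^sub><\<^sub>j q\<^sub>i\<^sub>j\<close> (\<open>evaluate_R_kernel_eq_multi_pf\<close>) is Schur's
  identity: with \<open>R\<^sub>i\<^sub>j = x\<^sub>i / x\<^sub>j\<close> one has \<open>q\<^sub>i\<^sub>j = (x\<^sub>j - x\<^sub>i) / (x\<^sub>j + x\<^sub>i)\<close>, and products of such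
  quotients satisfy the expansion rules that define the Pfaffian (\<open>schur_odd\<close>, \<open>schur_even\<close>). The
  classical proof is a partial fraction expansion, which becomes an induction that uses only the
  addition law relating \<open>q\<^sub>i\<^sub>j\<close>, \<open>q\<^sub>j\<^sub>k\<close>, \<open>q\<^sub>i\<^sub>k\<close> and the invertibility of these elements
  (\<open>partial_fractions\<close>).

  In the ring of power series in independent variables \<open>R\<^sub>i\<^sub>j\<close> the addition law fails, because
  \<open>R\<^sub>i\<^sub>j R\<^sub>j\<^sub>k = R\<^sub>i\<^sub>k\<close> holds only for the operators. Therefore each \<open>R\<^sub>i\<^sub>j\<close> is also
  represented by the product of the variables for the steps from \<open>i\<close> to \<open>j\<close>. These products are
  multiplicative, so that the addition law holds for the resulting quotients, and replacing one
  representation by the other does not change the value of a series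
  (\<open>evaluate_prod_R_quotient\<close>).
\<close>

section \<open>Geometric series\<close>

definition total_degree :: "('v \<Rightarrow>\<^sub>0 nat) \<Rightarrow> nat" where
  "total_degree m = Sum_any (Poly_Mapping.lookup m)"

lemma total_degree_add: "total_degree (a + b) = total_degree a + total_degree b"
  unfolding total_degree_def lookup_add by (rule Sum_any.distrib) simp_all

lemma total_degree_pos: "a \<noteq> 0 \<Longrightarrow> 0 < total_degree a"
  unfolding total_degree_def
  by (metis (full_types) Sum_any_eq_zero_iff finite_lookup gr0I lookup_zero poly_mapping_eqI)

lemma mcoeff_power_eq_0:
  assumes "mcoeff f 0 = 0" "total_degree m < n"
  shows "mcoeff (f ^ n) m = 0"
  using assms(2)
proof (induction n arbitrary: m)
  case (Suc n)
  have "mcoeff f a * mcoeff (f ^ n) b = 0" if "a + b = m" for a b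
  proof (cases "a = 0")
    case False
    thus ?thesis
      using Suc total_degree_pos[OF False] total_degree_add[of a b] that by simp
  qed (use assms in simp)
  thus ?case
    unfolding power_Suc mcoeff_times by (intro sum.neutral) auto
qed simp

text \<open>
  The series \<open>\<Sum>n. f ^ n\<close>. If \<open>f\<close> has no constant term, the powers beyond the degree of a monomial
  do not contribute to its coefficient, so that a finite sum suffices for each coefficient.
\<close>

definition geometric_series :: "'v mfps \<Rightarrow> 'v mfps" where
  "geometric_series f = Abs_mfps (\<lambda>m. \<Sum>n \<le> total_degree m. mcoeff (f ^ n) m)"

lemma geometric_series:
  fixes f :: "'v mfps"
  assumes "mcoeff f 0 = 0"
  shows "(1 - f) * geometric_series f = 1"
proof (rule mfps_eqI)
  fix m :: "'v \<Rightarrow>\<^sub>0 nat"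
  define N where "N = total_degree m"
  \<comment> \<open>Up to degree \<open>N\<close> one truncation, the same for all monomials, gives the right coefficients;
    for it the telescoping formula is available.\<close>
  have trunc: "mcoeff (geometric_series f) b = mcoeff (\<Sum>n \<le> N. f ^ n) b" if "total_degree b \<le> N" for b
    unfolding geometric_series_def mcoeff_Abs mcoeff_sum
    by (rule sum.mono_neutral_left) (use that mcoeff_power_eq_0[OF assms] in auto)
  have "mcoeff ((1 - f) * geometric_series f) m = mcoeff ((1 - f) * (\<Sum>n \<le> N. f ^ n)) m"
    unfolding mcoeff_times
    by (intro sum.cong refl) (auto simp: trunc N_def total_degree_add)
  also have "(1 - f) * (\<Sum>n \<le> N. f ^ n) = 1 - f ^ Suc N"
    by (simp add: sum_gp_basic)
  also have "mcoeff (1 - f ^ Suc N) m = mcoeff 1 m"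
    using mcoeff_power_eq_0[OF assms, of m "Suc N"] by (simp add: N_def del: power_Suc)
  finally show "mcoeff ((1 - f) * geometric_series f) m = mcoeff 1 m" .
qed

section \<open>Schur's Pfaffian identity\<close>

definition pairs_in :: "nat set \<Rightarrow> (nat \<times> nat) set" where
  "pairs_in S = {(i, j). i \<in> S \<and> j \<in> S \<and> i < j}"

lemma finite_pairs_in: "finite S \<Longrightarrow> finite (pairs_in S)"
  by (rule finite_subset[of _ "S \<times> S"]) (auto simp: pairs_in_def)

text \<open>
  An abstract version of \<open>F i j = (x\<^sub>j - x\<^sub>i) / (x\<^sub>j + x\<^sub>i)\<close> with inverses \<open>H i j\<close>. The third law is the
  addition theorem of the hyperbolic tangent, to which \<open>F\<close> is related by \<open>x\<^sub>i = exp (2 * y\<^sub>i)\<close> and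
  \<open>F i j = tanh (y\<^sub>j - y\<^sub>i)\<close>.
\<close>

locale schur_kernel =
  fixes F H :: "nat \<Rightarrow> nat \<Rightarrow> 'a :: comm_ring_1"
  assumes skew: "i \<noteq> j \<Longrightarrow> F j i = - F i j"
    and inverse: "i \<noteq> j \<Longrightarrow> F i j * H i j = 1"
    and triangle: "a \<noteq> i \<Longrightarrow> a \<noteq> j \<Longrightarrow> i \<noteq> j \<Longrightarrow> F i j * F a i * F a j = F i j + F a i - F a j"
begin

lemma skew_inverse:
  assumes "i \<noteq> j"
  shows "H j i = - H i j"
proof -
  have "H j i = H j i * (F i j * H i j)"
    using inverse[OF assms] by simp
  also have "\<dots> = - (F j i * H j i) * H i j"
    using skew[OF assms] by (simp add: algebra_simps)
  also have "\<dots> = - H i j"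
    using inverse[of j i] assms by simp
  finally show ?thesis .
qed

text \<open>
  The coefficient of \<open>F z j\<close> in the partial fraction expansion of \<open>\<Prod>j \<in> J. F z j\<close> as a function of
  the point \<open>z\<close>.
\<close>

definition residue_coeff :: "nat set \<Rightarrow> nat \<Rightarrow> 'a" where
  "residue_coeff J j = (\<Prod>i \<in> J - {j}. H j i)"

lemma residue_coeff_insert:
  assumes "finite J" "a \<notin> J"
  shows "residue_coeff (insert a J) a = (\<Prod>i \<in> J. H a i)"
    "j \<in> J \<Longrightarrow> residue_coeff (insert a J) j = residue_coeff J j * H j a"
proof -
  show "residue_coeff (insert a J) a = (\<Prod>i \<in> J. H a i)"
    using assms by (simp add: residue_coeff_def)
  assume j: "j \<in> J"
  have "insert a J - {j} = insert a (J - {j})" using j assms by auto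
  thus "residue_coeff (insert a J) j = residue_coeff J j * H j a"
    using assms by (simp add: residue_coeff_def mult.commute)
qed

text \<open>
  Replacing \<open>x\<^sub>a\<close> by \<open>- x\<^sub>a\<close> turns \<open>F a i\<close> into \<open>H a i\<close> and leaves \<open>F i j\<close> alone, so the triangle
  law persists.
\<close>

lemma inverse_triangle:
  assumes "a \<noteq> i" "a \<noteq> j" "i \<noteq> j"
  shows "F i j * H a i * H a j = F i j + H a i - H a j"
proof -
  have "F i j * H a i * H a j =
      (F i j * F a i * F a j - F a i + F a j) * H a i * H a j"
    using triangle[OF assms] by simp
  also have "\<dots> = F i j * (F a i * H a i) * (F a j * H a j) - (F a i * H a i) * H a j
      + (F a j * H a j) * H a i"
    by (simp add: algebra_simps)
  also have "\<dots> = F i j + H a i - H a j"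
    using assms by (simp add: inverse)
  finally show ?thesis .
qed

text \<open>
  The function \<open>f\<close> plays the role of \<open>j \<mapsto> F z j\<close> for a point \<open>z\<close>, of which only the triangle law
  relative to points of \<open>J\<close> matters. The generality is needed in the induction: when a point \<open>a\<close> is
  added, the new coefficient \<open>\<Prod>j \<in> J. H a j\<close> is itself a value of the product, at the point
  \<open>- x\<^sub>a\<close>, and is expanded by the induction hypothesis for \<open>f = H a\<close>.
\<close>

lemma partial_fractions:
  assumes "finite J"
    and "\<And>i j. i \<in> J \<Longrightarrow> j \<in> J \<Longrightarrow> i \<noteq> j \<Longrightarrow> F i j * f i * f j = F i j + f i - f j"
  shows "(\<Prod>j \<in> J. f j) = 1 + (\<Sum>j \<in> J. residue_coeff J j * (f j - 1))"
  using assms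
proof (induction J arbitrary: f rule: finite_induct)
  case (insert a J)
  let ?B = "residue_coeff J"
  have f: "(\<Prod>j \<in> J. f j) = 1 + (\<Sum>j \<in> J. ?B j * (f j - 1))"
    by (rule insert.IH) (use insert.prems in auto)
  have Ha: "(\<Prod>j \<in> J. H a j) = 1 + (\<Sum>j \<in> J. ?B j * (H a j - 1))"
    by (rule insert.IH, rule inverse_triangle) (use insert.hyps in auto)
  have prod: "f a * f j = 1 + H j a * (f j - f a)" if "j \<in> J" for j
  proof -
    have ne: "j \<noteq> a" using that insert.hyps by auto
    have "f a * f j = (F j a * H j a) * f j * f a"
      using inverse[OF ne] by (simp add: mult.commute)
    also have "\<dots> = (F j a * f j * f a) * H j a" by (simp add: algebra_simps)
    also have "\<dots> = (F j a + f j - f a) * H j a"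
      using insert.prems[of j a] that ne by simp
    also have "\<dots> = F j a * H j a + H j a * (f j - f a)" by (simp add: algebra_simps)
    finally show ?thesis using inverse[OF ne] by simp
  qed
  have termwise: "?B j * (f a * (f j - 1)) =
      ?B j * ((f a - 1) * (H a j - 1)) + ?B j * (H j a * (f j - 1))" if "j \<in> J" for j
  proof -
    have "H a j = - H j a" using that insert.hyps by (intro skew_inverse) auto
    moreover have "f a * (f j - 1) = 1 + H j a * (f j - f a) - f a"
      using prod[OF that] by (simp add: algebra_simps)
    ultimately have "f a * (f j - 1) = (f a - 1) * (H a j - 1) + H j a * (f j - 1)"
      by (simp add: algebra_simps)
    thus ?thesis by (simp only: distrib_left)
  qed
  have "(\<Prod>j \<in> insert a J. f j) = f a + (\<Sum>j \<in> J. ?B j * (f a * (f j - 1)))"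
    using insert.hyps by (simp add: f distrib_left sum_distrib_left ac_simps)
  also have "(\<Sum>j \<in> J. ?B j * (f a * (f j - 1))) =
      (f a - 1) * (\<Sum>j \<in> J. ?B j * (H a j - 1)) + (\<Sum>j \<in> J. ?B j * H j a * (f j - 1))"
    by (simp add: termwise sum.distrib) (simp add: sum_distrib_left ac_simps)
  also have "f a + \<dots> = 1 + (f a - 1) * (\<Prod>j \<in> J. H a j) + (\<Sum>j \<in> J. ?B j * H j a * (f j - 1))"
    unfolding Ha by (simp add: distrib_left)
  also have "\<dots> = 1 + (\<Sum>j \<in> insert a J. residue_coeff (insert a J) j * (f j - 1))"
    using insert.hyps by (simp add: residue_coeff_insert ac_simps)
  finally show ?case .
qed simp

text \<open>
  Expanding the coefficient of a new point \<open>a\<close> as in \<open>partial_fractions\<close> shows that the sums for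
  \<open>insert a J\<close> and \<open>J\<close> add up to \<open>1\<close>.
\<close>

lemma sum_residue_coeff:
  "finite J \<Longrightarrow> (\<Sum>j \<in> J. residue_coeff J j) = (if odd (card J) then 1 else 0)"
proof (induction J rule: finite_induct)
  case (insert a J)
  have "(\<Prod>j \<in> J. H a j) = 1 + (\<Sum>j \<in> J. residue_coeff J j * (H a j - 1))"
    by (rule partial_fractions, fact, rule inverse_triangle) (use insert.hyps in auto)
  also have "(\<Sum>j \<in> J. residue_coeff J j * (H a j - 1)) =
      (\<Sum>j \<in> J. - residue_coeff J j - residue_coeff J j * H j a)"
  proof (intro sum.cong refl)
    fix j assume "j \<in> J"
    hence "H a j = - H j a" using insert.hyps by (intro skew_inverse) auto
    thus "residue_coeff J j * (H a j - 1) = - residue_coeff J j - residue_coeff J j * H j a"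
      by (simp add: algebra_simps)
  qed
  finally show ?case
    using insert by (simp add: residue_coeff_insert sum_subtractf sum_negf)
qed simp

definition kernel_prod :: "nat set \<Rightarrow> 'a" where
  "kernel_prod S = (\<Prod>(i, j) \<in> pairs_in S. F i j)"

text \<open>
  Multiplication by the coefficient of \<open>t\<close> cancels all factors that involve \<open>t\<close>. The sign comes from
  the factors \<open>F i t\<close> with \<open>i < t\<close>, which are stored in the opposite order.
\<close>

lemma kernel_prod_remove:
  assumes "finite S" "t \<in> S"
  shows "kernel_prod S * residue_coeff S t = (- 1) ^ card {i \<in> S. i < t} * kernel_prod (S - {t})"
proof -
  let ?L = "{i \<in> S. i < t}" and ?U = "{i \<in> S. t < i}"
  have split: "pairs_in S = pairs_in (S - {t}) \<union> ((\<lambda>i. (i, t)) ` ?L \<union> (\<lambda>i. (t, i)) ` ?U)"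
    using assms(2) by (auto simp: pairs_in_def)
  have "kernel_prod S = kernel_prod (S - {t}) * ((\<Prod>i \<in> ?L. F i t) * (\<Prod>i \<in> ?U. F t i))"
    unfolding kernel_prod_def split using assms(1)
    by (subst prod.union_disjoint, simp add: finite_pairs_in, simp, force simp: pairs_in_def,
        subst prod.union_disjoint, simp, simp, force,
        simp add: prod.reindex inj_on_def)
  also have "(\<Prod>i \<in> ?L. F i t) = (\<Prod>i \<in> ?L. (- 1) * F t i)"
  proof (intro prod.cong refl)
    fix i assume "i \<in> ?L"
    thus "F i t = (- 1) * F t i" by (simp add: skew[of t i])
  qed
  also have "\<dots> = (- 1) ^ card ?L * (\<Prod>i \<in> ?L. F t i)"
    by (simp add: prod.distrib del: mult_minus_left mult_minus1)
  finally have K: "kernel_prod S =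
      (- 1) ^ card ?L * kernel_prod (S - {t}) * ((\<Prod>i \<in> ?L. F t i) * (\<Prod>i \<in> ?U. F t i))"
    by (simp add: ac_simps)
  have "(\<Prod>i \<in> ?L. F t i) * (\<Prod>i \<in> ?U. F t i) = (\<Prod>i \<in> ?L \<union> ?U. F t i)"
    using assms(1) by (intro prod.union_disjoint[symmetric]) auto
  also have "?L \<union> ?U = S - {t}" by auto
  finally have "kernel_prod S * residue_coeff S t = (- 1) ^ card ?L * kernel_prod (S - {t}) *
      ((\<Prod>i \<in> S - {t}. F t i) * (\<Prod>i \<in> S - {t}. H t i))"
    by (simp add: K residue_coeff_def ac_simps)
  also have "(\<Prod>i \<in> S - {t}. F t i) * (\<Prod>i \<in> S - {t}. H t i) = (\<Prod>i \<in> S - {t}. 1)"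
    unfolding prod.distrib[symmetric] by (intro prod.cong refl) (auto intro: inverse)
  finally show ?thesis by simp
qed

lemma schur_odd:
  assumes "finite S" "odd (card S)"
  shows "kernel_prod S = (\<Sum>t \<in> S. (- 1) ^ card {i \<in> S. i < t} * kernel_prod (S - {t}))"
proof -
  have "kernel_prod S = kernel_prod S * (\<Sum>t \<in> S. residue_coeff S t)"
    using assms by (simp add: sum_residue_coeff)
  thus ?thesis
    using assms by (simp add: sum_distrib_left kernel_prod_remove)
qed

lemma schur_even:
  assumes "finite J" "odd (card J)" "\<And>t. t \<in> J \<Longrightarrow> a < t"
  shows "kernel_prod (insert a J) =
    (\<Sum>t \<in> J. (- 1) ^ card {i \<in> J. i < t} * (F a t * kernel_prod (J - {t})))"
proof -
  have a: "a \<notin> J" using assms(3) by blast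
  have split: "pairs_in (insert a J) = pairs_in J \<union> (\<lambda>i. (a, i)) ` J"
    using assms(3) by (auto simp: pairs_in_def dest: order.asym)
  have "kernel_prod (insert a J) = kernel_prod J * (\<Prod>t \<in> J. F a t)"
    unfolding kernel_prod_def split using assms(1) a
    by (subst prod.union_disjoint, simp add: finite_pairs_in, simp, force simp: pairs_in_def,
        simp add: prod.reindex inj_on_def)
  also have "(\<Prod>t \<in> J. F a t) = 1 + (\<Sum>t \<in> J. residue_coeff J t * (F a t - 1))"
    by (rule partial_fractions, fact, rule triangle) (use a in auto)
  also have "\<dots> = (\<Sum>t \<in> J. residue_coeff J t * F a t)"
    using assms by (simp add: sum_residue_coeff right_diff_distrib sum_subtractf)
  also have "kernel_prod J * \<dots> = (\<Sum>t \<in> J. (kernel_prod J * residue_coeff J t) * F a t)"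
    by (simp add: sum_distrib_left ac_simps)
  also have "\<dots> = (\<Sum>t \<in> J. (- 1) ^ card {i \<in> J. i < t} * (F a t * kernel_prod (J - {t})))"
    using assms by (intro sum.cong refl) (simp add: kernel_prod_remove ac_simps)
  finally show ?thesis .
qed

end

section \<open>The kernel of raising operators\<close>

text \<open>
  The operator \<open>R\<^sub>i\<^sub>j\<close> written as the composite of the steps \<open>R\<^sub>l\<^sub>,\<^sub>l\<^sub>+\<^sub>1\<close> for \<open>i \<le> l < j\<close>.
\<close>

definition path_prod :: "nat \<Rightarrow> nat \<Rightarrow> (nat \<times> nat) mfps" where
  "path_prod i j = (\<Prod>l = i..<j. mvar (l, Suc l))"

lemma path_prod_mult: "i \<le> j \<Longrightarrow> j \<le> k \<Longrightarrow> path_prod i j * path_prod j k = path_prod i k"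
  unfolding path_prod_def by (rule prod.atLeastLessThan_concat)

lemma mcoeff_path_prod_0: "i < j \<Longrightarrow> mcoeff (path_prod i j) 0 = 0"
  unfolding path_prod_def by (subst prod.atLeast_Suc_lessThan) (simp_all add: mcoeff_mvar_times_eq_0)

text \<open>
  The quotient \<open>(1 - R\<^sub>i\<^sub>j) / (1 + R\<^sub>i\<^sub>j)\<close> in this representation, extended to \<open>j \<le> i\<close> by skew symmetry.
\<close>

definition path_quotient :: "nat \<Rightarrow> nat \<Rightarrow> (nat \<times> nat) mfps" where
  "path_quotient i j = (if i < j then (1 - path_prod i j) * geometric_series (- path_prod i j)
     else - ((1 - path_prod j i) * geometric_series (- path_prod j i)))"

definition path_quotient_inv :: "nat \<Rightarrow> nat \<Rightarrow> (nat \<times> nat) mfps" where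
  "path_quotient_inv i j = (if i < j then (1 + path_prod i j) * geometric_series (path_prod i j)
     else - ((1 + path_prod j i) * geometric_series (path_prod j i)))"

lemma geometric_series_path_prod:
  assumes "i < j"
  shows "(1 - path_prod i j) * geometric_series (path_prod i j) = 1"
    "(1 + path_prod i j) * geometric_series (- path_prod i j) = 1"
  using geometric_series[of "path_prod i j"] geometric_series[of "- path_prod i j"]
    mcoeff_path_prod_0[OF assms] by simp_all

lemma path_quotient_eq:
  assumes "i < j"
  shows "(1 + path_prod i j) * path_quotient i j = 1 - path_prod i j"
proof -
  have "(1 + path_prod i j) * path_quotient i j =
      (1 - path_prod i j) * ((1 + path_prod i j) * geometric_series (- path_prod i j))"
    using assms by (simp add: path_quotient_def ac_simps)
  thus ?thesis
    by (simp add: geometric_series_path_prod[OF assms])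
qed

lemma path_quotient_skew: "i \<noteq> j \<Longrightarrow> path_quotient j i = - path_quotient i j"
  by (auto simp: path_quotient_def)

lemma path_quotient_inverse_less:
  assumes "i < j"
  shows "path_quotient i j * path_quotient_inv i j = 1"
proof -
  have "path_quotient i j * path_quotient_inv i j =
      ((1 - path_prod i j) * geometric_series (path_prod i j)) *
      ((1 + path_prod i j) * geometric_series (- path_prod i j))"
    using assms by (simp add: path_quotient_def path_quotient_inv_def ac_simps)
  thus ?thesis
    by (simp add: geometric_series_path_prod[OF assms])
qed

text \<open>
  With \<open>x\<close> and \<open>y\<close> for the two path products and \<open>x * y\<close> for the product of the whole path, the claim
  is a polynomial identity after multiplication by the unit \<open>(1 + x) * (1 + y) * (1 + x * y)\<close>.
\<close>

lemma path_quotient_triangle_less: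
  assumes "i < j" "j < k"
  shows "path_quotient i j * path_quotient j k * path_quotient i k =
    path_quotient i j + path_quotient j k - path_quotient i k"
proof -
  define x y f g h where "x = path_prod i j" and "y = path_prod j k"
    and "f = path_quotient i j" and "g = path_quotient j k" and "h = path_quotient i k"
  define u where "u = (1 + x) * (1 + y) * (1 + x * y)"
  define u' where "u' = geometric_series (- x) * geometric_series (- y) * geometric_series (- (x * y))"
  have xy: "path_prod i k = x * y"
    unfolding x_def y_def using assms by (simp add: path_prod_mult)
  have f: "(1 + x) * f = 1 - x" and g: "(1 + y) * g = 1 - y" and h: "(1 + x * y) * h = 1 - x * y"
    using path_quotient_eq[of i j] path_quotient_eq[of j k] path_quotient_eq[of i k] assms
    by (simp_all add: x_def[symmetric] y_def[symmetric] f_def[symmetric] g_def[symmetric] h_def[symmetric] xy)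
  have "u * u' = ((1 + x) * geometric_series (- x)) * ((1 + y) * geometric_series (- y)) *
      ((1 + x * y) * geometric_series (- (x * y)))"
    unfolding u_def u'_def by (simp only: ac_simps)
  hence uu': "u * u' = 1"
    using geometric_series_path_prod(2)[of i j] geometric_series_path_prod(2)[of j k]
      geometric_series_path_prod(2)[of i k] assms
    by (simp add: x_def[symmetric] y_def[symmetric] xy)
  have "u * (f * g * h) = ((1 + x) * f) * ((1 + y) * g) * ((1 + x * y) * h)"
    unfolding u_def by (simp only: ac_simps)
  also have "\<dots> = (1 - x) * (1 - y) * (1 - x * y)"
    by (simp only: f g h)
  also have "\<dots> = (1 - x) * ((1 + y) * (1 + x * y)) + (1 - y) * ((1 + x) * (1 + x * y))
      - (1 - x * y) * ((1 + x) * (1 + y))"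
    by (simp add: algebra_simps)
  also have "\<dots> = ((1 + x) * f) * ((1 + y) * (1 + x * y)) + ((1 + y) * g) * ((1 + x) * (1 + x * y))
      - ((1 + x * y) * h) * ((1 + x) * (1 + y))"
    by (simp only: f g h)
  also have "\<dots> = u * (f + g - h)"
    unfolding u_def by (simp add: algebra_simps)
  finally have "u' * (u * (f * g * h)) = u' * (u * (f + g - h))"
    by simp
  hence "(u * u') * (f * g * h) = (u * u') * (f + g - h)"
    by (simp only: ac_simps)
  thus ?thesis
    by (simp add: uu' f_def g_def h_def)
qed

text \<open>
  The triangle law is symmetric under permutations of the three indices up to an overall sign, so all
  orderings reduce to the increasing one.
\<close>

interpretation path: schur_kernel path_quotient path_quotient_inv
proof
  fix i j :: nat
  assume ij: "i \<noteq> j"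
  show "path_quotient j i = - path_quotient i j"
    by (rule path_quotient_skew[OF ij])
  show "path_quotient i j * path_quotient_inv i j = 1"
  proof (cases "i < j")
    case False
    hence "j < i" using ij by simp
    moreover have "path_quotient i j * path_quotient_inv i j = path_quotient j i * path_quotient_inv j i"
      using \<open>j < i\<close> by (simp add: path_quotient_def path_quotient_inv_def)
    ultimately show ?thesis by (simp add: path_quotient_inverse_less)
  qed (rule path_quotient_inverse_less)
  fix a :: nat
  assume a: "a \<noteq> i" "a \<noteq> j"
  note triangle = path_quotient_triangle_less and skew = path_quotient_skew
  consider "a < i" "i < j" | "a < j" "j < i" | "i < a" "a < j" | "j < a" "a < i"
    | "i < j" "j < a" | "j < i" "i < a"
    using ij a by linarith
  thus "path_quotient i j * path_quotient a i * path_quotient a j =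
      path_quotient i j + path_quotient a i - path_quotient a j"
  proof cases
    case 1
    thus ?thesis using triangle[of a i j] by (simp add: algebra_simps)
  next
    case 2
    thus ?thesis using triangle[of a j i] skew[of j i] by (simp add: algebra_simps)
  next
    case 3
    thus ?thesis using triangle[of i a j] skew[of i a] by (simp add: algebra_simps)
  next
    case 4
    thus ?thesis using triangle[of j a i] skew[of j i] skew[of j a] by (simp add: algebra_simps)
  next
    case 5
    thus ?thesis using triangle[of i j a] skew[of i a] skew[of j a] by (simp add: algebra_simps)
  next
    case 6
    thus ?thesis using triangle[of j i a] skew[of j i] skew[of i a] skew[of j a] by (simp add: algebra_simps)
  qed
qed

section \<open>Applying a series of raising operators and substituting\<close>

text \<open>
  If all entries of \<open>raise e s\<close> are nonnegative then so is its weight \<open>\<Sum>i. i * raise e s ! i\<close>. Hence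
  only the exponents in this finite set contribute to a value at sequences that vanish at negative
  subscripts. The weight depends on \<open>raise e s\<close> alone, which makes the set compatible with the
  composition of operators.
\<close>

definition relevant_exponents :: "int list \<Rightarrow> (nat \<times> nat \<Rightarrow>\<^sub>0 nat) set" where
  "relevant_exponents s = {e. Poly_Mapping.keys e \<subseteq> index_pairs (length s) \<and>
     0 \<le> (\<Sum>i < length s. int i * raise e s ! i)}"

lemma finite_relevant_exponents: "finite (relevant_exponents s)"
  unfolding relevant_exponents_def by (rule finite_raise_weight)

definition monomial_value :: "(nat \<Rightarrow> int \<Rightarrow> 'a :: comm_ring_1) \<Rightarrow> int list \<Rightarrow> 'a" where
  "monomial_value c s = (\<Prod>i < length s. c i (s ! i))"

text \<open>
  The value of a series of raising operators on a monomial. Since the summation set does not depend on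
  the series, linearity in \<open>Q\<close> holds without side conditions.
\<close>

definition evaluate :: "(nat \<Rightarrow> int \<Rightarrow> 'a :: comm_ring_1) \<Rightarrow> int list \<Rightarrow> (nat \<times> nat) mfps \<Rightarrow> 'a" where
  "evaluate c s Q = (\<Sum>e \<in> relevant_exponents s. of_int (mcoeff Q e) * monomial_value c (raise e s))"

lemma evaluate_add: "evaluate c s (P + Q) = evaluate c s P + evaluate c s Q"
  by (simp add: evaluate_def distrib_right sum.distrib)

lemma evaluate_minus: "evaluate c s (- Q) = - evaluate c s Q"
  by (simp add: evaluate_def sum_negf)

lemma evaluate_diff: "evaluate c s (P - Q) = evaluate c s P - evaluate c s Q"
  by (simp add: evaluate_def left_diff_distrib sum_subtractf)

lemma evaluate_sum: "evaluate c s (\<Sum>x \<in> A. f x) = (\<Sum>x \<in> A. evaluate c s (f x))"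
  by (simp add: evaluate_def mcoeff_sum of_int_sum sum_distrib_right) (rule sum.swap)

lemma evaluate_sign: "evaluate c s ((- 1) ^ t * Q) = (- 1) ^ t * evaluate c s Q"
  by (cases "even t") (simp_all add: evaluate_minus)

lemma length_raise [simp]: "length (raise e s) = length s"
  by (simp add: raise_def)

text \<open>
  Exponents without the variable \<open>p\<close> do not occur in \<open>mvar p * Q\<close>, and the relevant exponents that
  contain \<open>p\<close> correspond to those for the raised subscripts by removing one \<open>p\<close>.
\<close>

lemma evaluate_mvar_times:
  assumes "p \<in> index_pairs (length s)"
  shows "evaluate c s (mvar p * Q) = evaluate c (raise (Poly_Mapping.single p 1) s) Q"
proof -
  let ?e = "Poly_Mapping.single p (1 :: nat)"
  have inj: "inj_on (\<lambda>e. e + ?e) (relevant_exponents (raise ?e s))"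
    by (simp add: inj_on_def)
  have lookup: "Poly_Mapping.lookup (e + ?e) p \<noteq> 0" for e
    by (simp add: lookup_add)
  have "evaluate c s (mvar p * Q) = (\<Sum>e \<in> (\<lambda>e. e + ?e) ` relevant_exponents (raise ?e s).
      of_int (mcoeff (mvar p * Q) e) * monomial_value c (raise e s))"
    unfolding evaluate_def
  proof (rule sum.mono_neutral_right[OF finite_relevant_exponents])
    show "(\<lambda>e. e + ?e) ` relevant_exponents (raise ?e s) \<subseteq> relevant_exponents s"
    proof
      fix e' assume "e' \<in> (\<lambda>e. e + ?e) ` relevant_exponents (raise ?e s)"
      then obtain e where e: "e \<in> relevant_exponents (raise ?e s)" "e' = e + ?e" by blast
      have "Poly_Mapping.keys (e + ?e) \<subseteq> index_pairs (length s)"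
        using Poly_Mapping.keys_add[of e ?e] e assms by (auto simp: relevant_exponents_def)
      thus "e' \<in> relevant_exponents s"
        using e by (simp add: relevant_exponents_def raise_add)
    qed
    show "\<forall>e \<in> relevant_exponents s - (\<lambda>e. e + ?e) ` relevant_exponents (raise ?e s).
        of_int (mcoeff (mvar p * Q) e) * monomial_value c (raise e s) = 0"
    proof
      fix e assume e: "e \<in> relevant_exponents s - (\<lambda>e. e + ?e) ` relevant_exponents (raise ?e s)"
      have "Poly_Mapping.lookup e p = 0"
      proof (rule ccontr)
        assume nz: "Poly_Mapping.lookup e p \<noteq> 0"
        have split: "e - ?e + ?e = e"
          by (rule poly_mapping_eqI) (use nz in \<open>auto simp: lookup_add lookup_minus lookup_single when_def\<close>)
        have "Poly_Mapping.keys (e - ?e) \<subseteq> Poly_Mapping.keys e"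
          by (auto simp: in_keys_iff lookup_minus)
        moreover have "raise (e - ?e) (raise ?e s) = raise e s"
          by (metis raise_add split)
        ultimately have "e - ?e \<in> relevant_exponents (raise ?e s)"
          using e by (auto simp: relevant_exponents_def)
        thus False
          using e split by (metis DiffE image_eqI)
      qed
      thus "of_int (mcoeff (mvar p * Q) e) * monomial_value c (raise e s) = 0"
        by (simp add: mcoeff_mvar_times)
    qed
  qed
  also have "\<dots> = evaluate c (raise ?e s) Q"
    unfolding evaluate_def sum.reindex[OF inj] o_def
    by (intro sum.cong refl) (simp add: mcoeff_mvar_times lookup_add raise_add)
  finally show ?thesis .
qed

lemma evaluate_one:
  assumes neg: "\<And>i r. r < 0 \<Longrightarrow> c i r = 0"
  shows "evaluate c s 1 = monomial_value c s"
proof (cases "0 \<in> relevant_exponents s")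
  case True
  have "evaluate c s 1 = (\<Sum>e \<in> {0}. of_int (mcoeff 1 e) * monomial_value c (raise e s))"
    unfolding evaluate_def
    by (rule sum.mono_neutral_right[OF finite_relevant_exponents]) (use True in auto)
  thus ?thesis by (simp add: raise_zero)
next
  case False
  hence "\<not> 0 \<le> (\<Sum>i < length s. int i * s ! i)"
    by (simp add: relevant_exponents_def raise_zero)
  moreover have "0 \<le> (\<Sum>i < length s. int i * s ! i)" if "\<forall>i < length s. 0 \<le> s ! i"
    using that by (intro sum_nonneg) auto
  ultimately have "\<not> (\<forall>i < length s. 0 \<le> s ! i)"
    by blast
  then obtain i where i: "i < length s" "s ! i < 0"
    by (auto simp: not_le)
  hence "monomial_value c s = 0"
    unfolding monomial_value_def using neg[of "s ! i" i] by (intro prod_zero) auto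
  moreover have "evaluate c s 1 = 0"
    unfolding evaluate_def using False by (intro sum.neutral) auto
  ultimately show ?thesis by simp
qed

lemma evaluate_eq_substitute:
  assumes neg: "\<And>i r. r < 0 \<Longrightarrow> c i r = 0" and Q: "mfps_in (index_pairs (length s)) Q"
  shows "substitute c (apply_series Q s) = evaluate c s Q"
proof -
  let ?R = "relevant_exponents s"
  have coeff: "apply_series Q s s' = (\<Sum>e \<in> {e \<in> ?R. raise e s = s'}. mcoeff Q e)"
    if "0 \<le> (\<Sum>i < length s. int i * s' ! i)" for s'
    unfolding apply_series_def
    by (rule sum.mono_neutral_left)
       (use Q that finite_subset[OF _ finite_relevant_exponents, of "{e \<in> ?R. raise e s = s'}" s]
        in \<open>auto simp: relevant_exponents_def mfps_in_def\<close>)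
  have "substitute c (apply_series Q s) =
      (\<Sum>s' \<in> (\<lambda>e. raise e s) ` ?R. of_int (apply_series Q s s') * (\<Prod>i < length s'. c i (s' ! i)))"
    unfolding substitute_def
  proof (rule Sum_any.expand_superset)
    show "finite ((\<lambda>e. raise e s) ` ?R)"
      by (intro finite_imageI finite_relevant_exponents)
    show "{s'. of_int (apply_series Q s s') * (\<Prod>i < length s'. c i (s' ! i)) \<noteq> 0} \<subseteq> (\<lambda>e. raise e s) ` ?R"
    proof
      fix s' assume "s' \<in> {s'. of_int (apply_series Q s s') * (\<Prod>i < length s'. c i (s' ! i)) \<noteq> 0}"
      hence "apply_series Q s s' \<noteq> 0" and P: "(\<Prod>i < length s'. c i (s' ! i)) \<noteq> 0"
        by auto
      then obtain e where e: "mcoeff Q e \<noteq> 0" "raise e s = s'"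
        unfolding apply_series_def by (auto elim: sum.not_neutral_contains_not_neutral)
      have len: "length s' = length s" using e by auto
      have "0 \<le> s' ! i" if "i < length s'" for i
      proof (rule ccontr)
        assume "\<not> 0 \<le> s' ! i"
        hence "(\<Prod>i < length s'. c i (s' ! i)) = 0"
          using that neg[of "s' ! i" i] by (intro prod_zero) auto
        thus False using P by simp
      qed
      hence "0 \<le> (\<Sum>i < length s. int i * raise e s ! i)"
        using len e(2) by (intro sum_nonneg) auto
      thus "s' \<in> (\<lambda>e. raise e s) ` ?R"
        using e Q by (auto simp: relevant_exponents_def mfps_in_def)
    qed
  qed
  also have "\<dots> = (\<Sum>s' \<in> (\<lambda>e. raise e s) ` ?R. \<Sum>e \<in> {e \<in> ?R. raise e s = s'}.
      of_int (mcoeff Q e) * monomial_value c (raise e s))"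
  proof (intro sum.cong refl)
    fix s' assume "s' \<in> (\<lambda>e. raise e s) ` ?R"
    hence "0 \<le> (\<Sum>i < length s. int i * s' ! i)"
      by (auto simp: relevant_exponents_def)
    thus "of_int (apply_series Q s s') * (\<Prod>i < length s'. c i (s' ! i)) =
        (\<Sum>e \<in> {e \<in> ?R. raise e s = s'}. of_int (mcoeff Q e) * monomial_value c (raise e s))"
      by (simp add: coeff of_int_sum sum_distrib_right monomial_value_def)
  qed
  also have "\<dots> = evaluate c s Q"
    unfolding evaluate_def by (rule sum.image_gen[symmetric, OF finite_relevant_exponents])
  finally show ?thesis .
qed

text \<open>
  If no operator of \<open>Q\<close> raises the \<open>j\<close>-th subscript, a negative subscript there stays negative.
\<close>

lemma evaluate_eq_0:
  assumes neg: "\<And>i r. r < 0 \<Longrightarrow> c i r = 0" and Q: "mfps_in U Q"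
    and j: "j < length s" "s ! j < 0" "\<And>k. (j, k) \<notin> U"
  shows "evaluate c s Q = 0"
  unfolding evaluate_def
proof (intro sum.neutral ballI)
  fix e
  show "of_int (mcoeff Q e) * monomial_value c (raise e s) = 0"
  proof (cases "mcoeff Q e = 0")
    case False
    hence "Poly_Mapping.lookup e (j, k) = 0" for k
      using Q j(3)[of k] by (auto simp: mfps_in_def in_keys_iff subset_iff)
    hence "raise e s ! j = s ! j - (\<Sum>k < length s. int (Poly_Mapping.lookup e (k, j)))"
      using j(1) by (simp add: raise_def)
    also have "\<dots> \<le> s ! j" by (simp add: sum_nonneg)
    finally have "c j (raise e s ! j) = 0" using j(2) neg by simp
    hence "monomial_value c (raise e s) = 0"
      unfolding monomial_value_def using j(1) by (intro prod_zero) auto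
    thus ?thesis by simp
  qed simp
qed

section \<open>Evaluating the two kernels\<close>

text \<open>
  The lowering of a subscript by one step is undone by the next step of the path.
\<close>

lemma evaluate_path_prod:
  assumes "i < j" "j < length s"
  shows "evaluate c s (path_prod i j * Q) = evaluate c s (mvar (i, j) * Q)"
  using assms
proof (induction j arbitrary: Q)
  case (Suc j)
  show ?case
  proof (cases "i = j")
    case True
    thus ?thesis by (simp add: path_prod_def)
  next
    case False
    hence ij: "i < j" using Suc.prems by simp
    have j: "(j, Suc j) \<in> index_pairs (length s)" "(i, j) \<in> index_pairs (length s)"
      "(i, Suc j) \<in> index_pairs (length s)"
      using Suc.prems ij by (auto simp: index_pairs_def)
    have "path_prod i (Suc j) * Q = path_prod i j * (mvar (j, Suc j) * Q)"
      using ij by (simp add: path_prod_def ac_simps)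
    hence "evaluate c s (path_prod i (Suc j) * Q) = evaluate c s (mvar (i, j) * (mvar (j, Suc j) * Q))"
      using Suc.IH[OF ij] Suc.prems by simp
    also have "\<dots> = evaluate c (raise (Poly_Mapping.single (j, Suc j) 1) (raise (Poly_Mapping.single (i, j) 1) s)) Q"
      using j by (simp only: evaluate_mvar_times length_raise)
    also have "raise (Poly_Mapping.single (j, Suc j) 1) (raise (Poly_Mapping.single (i, j) 1) s) =
        raise (Poly_Mapping.single (i, Suc j) 1) s"
    proof -
      have "raise (Poly_Mapping.single (j, Suc j) 1) (raise (Poly_Mapping.single (i, j) 1) s) =
        raise (Poly_Mapping.single (j, Suc j) 1) (s[i := s ! i + 1, j := s ! j - 1])"
        using ij Suc.prems by (subst raise_single[of i j]) auto
      also have "\<dots> = s[i := s ! i + 1, j := s ! j - 1, j := s ! j, Suc j := s ! Suc j - 1]"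
        using ij Suc.prems by (subst raise_single) auto
      also have "\<dots> = s[i := s ! i + 1, Suc j := s ! Suc j - 1]"
      proof -
        have "s[i := s ! i + 1, j := s ! j] = s[i := s ! i + 1]"
          using list_update_id[of "s[i := s ! i + 1]" j] ij by simp
        thus ?thesis by simp
      qed
      finally show ?thesis
        using ij Suc.prems by (subst raise_single[of i "Suc j"]) auto
    qed
    also have "evaluate c (raise (Poly_Mapping.single (i, Suc j) 1) s) Q = evaluate c s (mvar (i, Suc j) * Q)"
      using j by (simp only: evaluate_mvar_times)
    finally show ?thesis .
  qed
qed simp

text \<open>
  Write \<open>Q = (1 + y) * Q'\<close> with the path product \<open>y\<close>. The factor \<open>1 + y\<close> cancels the denominator of
  \<open>path_quotient i j\<close> directly, and that of \<open>R_quotient (i, j)\<close> after trading \<open>y\<close> for the variable;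
  trading back in the numerator gives the same value.
\<close>

lemma evaluate_R_quotient:
  assumes "(i, j) \<in> index_pairs (length s)"
  shows "evaluate c s (R_quotient (i, j) * Q) = evaluate c s (path_quotient i j * Q)"
proof -
  have ij: "i < j" "j < length s" using assms by (auto simp: index_pairs_def)
  let ?y = "path_prod i j" and ?x = "mvar (i, j)"
  define Q' where "Q' = geometric_series (- ?y) * Q"
  have Q: "Q = (1 + ?y) * Q'"
    using geometric_series_path_prod(2)[OF ij(1)] by (simp add: Q'_def mult.assoc[symmetric])
  note swap = evaluate_path_prod[OF ij]
  have "evaluate c s (R_quotient (i, j) * Q) =
      evaluate c s (R_quotient (i, j) * Q') + evaluate c s (?y * (R_quotient (i, j) * Q'))"
    unfolding evaluate_add[symmetric] by (simp add: Q algebra_simps)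
  also have "\<dots> = evaluate c s ((1 + ?x) * R_quotient (i, j) * Q')"
    unfolding swap evaluate_add[symmetric] by (simp add: algebra_simps)
  also have "\<dots> = evaluate c s Q' - evaluate c s (?x * Q')"
    by (simp add: R_quotient_eq left_diff_distrib evaluate_diff)
  also have "\<dots> = evaluate c s ((1 - ?y) * Q')"
    by (simp add: swap[symmetric] left_diff_distrib evaluate_diff)
  also have "(1 - ?y) * Q' = path_quotient i j * Q"
    by (simp only: path_quotient_eq[OF ij(1), symmetric] Q ac_simps)
  finally show ?thesis .
qed

lemma evaluate_prod_R_quotient:
  assumes "U \<subseteq> index_pairs (length s)"
  shows "evaluate c s (A * (\<Prod>p \<in> U. R_quotient p)) = evaluate c s (A * (\<Prod>(i, j) \<in> U. path_quotient i j))"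
proof -
  have "finite U" using assms finite_index_pairs by (rule finite_subset)
  thus ?thesis using assms
  proof (induction U arbitrary: A rule: finite_induct)
    case (insert p U)
    obtain i j where p: "p = (i, j)" by force
    have "evaluate c s (A * (\<Prod>p \<in> insert p U. R_quotient p)) =
        evaluate c s (R_quotient (i, j) * (A * (\<Prod>p \<in> U. R_quotient p)))"
      using insert.hyps by (simp add: p ac_simps)
    also have "\<dots> = evaluate c s ((path_quotient i j * A) * (\<Prod>p \<in> U. R_quotient p))"
      using insert.prems by (subst evaluate_R_quotient) (auto simp: p ac_simps)
    also have "\<dots> = evaluate c s ((path_quotient i j * A) * (\<Prod>(i, j) \<in> U. path_quotient i j))"
      using insert by simp
    finally show ?case using insert.hyps by (simp add: p ac_simps)
  qed simp
qed

lemma evaluate_mvar_power_times: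
  assumes "i < j" "j < length s"
  shows "evaluate c s (mvar (i, j) ^ t * Q) = evaluate c (s[i := s ! i + int t, j := s ! j - int t]) Q"
  using assms
proof (induction t arbitrary: s)
  case (Suc t)
  have "evaluate c s (mvar (i, j) ^ Suc t * Q) =
      evaluate c (raise (Poly_Mapping.single (i, j) 1) s) (mvar (i, j) ^ t * Q)"
    using Suc.prems by (subst evaluate_mvar_times[symmetric]) (auto simp: index_pairs_def ac_simps)
  also have "raise (Poly_Mapping.single (i, j) 1) s = s[i := s ! i + 1, j := s ! j - 1]"
    using Suc.prems by (intro raise_single) auto
  also have "evaluate c \<dots> (mvar (i, j) ^ t * Q) =
     evaluate c (s[i := s ! i + 1, j := s ! j - 1, i := s ! i + int (Suc t), j := s ! j - int (Suc t)]) Q"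
    using Suc.prems by (subst Suc.IH) (simp_all add: algebra_simps)
  also have "s[i := s ! i + 1, j := s ! j - 1, i := s ! i + int (Suc t), j := s ! j - int (Suc t)] =
      s[i := s ! i + int (Suc t), j := s ! j - int (Suc t)]"
    using Suc.prems by (simp add: list_update_swap[of i j])
  finally show ?case .
qed simp

text \<open>
  The series \<open>W = 1 + R_quotient p\<close> satisfies \<open>W = 2 - mvar p * W\<close>; the induction unfolds this
  equation once per step, and so yields an exact remainder.
\<close>

lemma R_quotient_truncate:
  "R_quotient p = 1 + 2 * (\<Sum>t = 1..N. (- 1) ^ t * mvar p ^ t) + (- 1) ^ Suc N * (mvar p ^ Suc N * (1 + R_quotient p))"
proof (induction N)
  case 0
  show ?case using R_quotient_eq[of p] by (simp add: algebra_simps)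
next
  case (Suc N)
  let ?v = "mvar p" and ?W = "1 + R_quotient p"
  have W: "?W = 2 - ?v * ?W"
    using R_quotient_eq[of p] by (simp add: algebra_simps)
  have "(- 1) ^ Suc N * (?v ^ Suc N * ?W) = (- 1) ^ Suc N * (?v ^ Suc N * (2 - ?v * ?W))"
    by (rule arg_cong[OF W])
  also have "\<dots> = 2 * ((- 1) ^ Suc N * ?v ^ Suc N) + (- 1) ^ Suc (Suc N) * (?v ^ Suc (Suc N) * ?W)"
    by (simp add: algebra_simps)
  finally have step: "(- 1) ^ Suc N * (?v ^ Suc N * ?W) =
      2 * ((- 1) ^ Suc N * ?v ^ Suc N) + (- 1) ^ Suc (Suc N) * (?v ^ Suc (Suc N) * ?W)" .
  have sum: "(\<Sum>t = 1..Suc N. (- 1) ^ t * ?v ^ t) = (\<Sum>t = 1..N. (- 1) ^ t * ?v ^ t) + (- 1) ^ Suc N * ?v ^ Suc N"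
    by (simp del: power_Suc)
  note Suc.IH
  also have "1 + 2 * (\<Sum>t = 1..N. (- 1) ^ t * ?v ^ t) + (- 1) ^ Suc N * (?v ^ Suc N * ?W) =
      1 + 2 * (\<Sum>t = 1..Suc N. (- 1) ^ t * ?v ^ t) + (- 1) ^ Suc (Suc N) * (?v ^ Suc (Suc N) * ?W)"
    by (simp only: step sum distrib_left[of 2] add.assoc)
  finally show ?case .
qed

lemma mfps_in_mono: "mfps_in U f \<Longrightarrow> U \<subseteq> V \<Longrightarrow> mfps_in V f"
  by (auto simp: mfps_in_def)

lemma mfps_in_R_quotient: "mfps_in {p} (R_quotient p)"
  by (auto simp: mfps_in_def R_quotient_def split: if_splits)

text \<open>
  The remainder in \<open>R_quotient_truncate\<close> has no value: after more than \<open>s ! j\<close> applications of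
  \<open>R\<^sub>i\<^sub>j\<close> the \<open>j\<close>-th subscript is negative, and neither \<open>A\<close> nor \<open>R\<^sub>i\<^sub>j\<close> can raise it again.
\<close>

lemma evaluate_R_quotient_expand:
  assumes neg: "\<And>i r. r < 0 \<Longrightarrow> c i r = 0" and ij: "i < j" "j < length s"
    and A: "mfps_in U A" "\<And>k. (j, k) \<notin> U"
  shows "evaluate c s (R_quotient (i, j) * A) = evaluate c s A +
    2 * (\<Sum>t = 1..nat (s ! j). (- 1) ^ t * evaluate c (s[i := s ! i + int t, j := s ! j - int t]) A)"
proof -
  let ?N = "nat (s ! j)" and ?v = "mvar (i, j)" and ?W = "1 + R_quotient (i, j)"
  have W: "mfps_in (insert (i, j) U) (?W * A)"
  proof (rule mfps_in_times)
    show "mfps_in (insert (i, j) U) ?W"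
      using mfps_in_R_quotient[of "(i, j)"] by (auto simp: mfps_in_def split: if_splits)
    show "mfps_in (insert (i, j) U) A" using A(1) by (rule mfps_in_mono) auto
  qed
  have "evaluate c s (?v ^ Suc ?N * (?W * A)) = 0"
    using ij A(2) by (subst evaluate_mvar_power_times, simp, simp, intro evaluate_eq_0[OF neg W, where j = j]) auto
  moreover have "R_quotient (i, j) * A = A + ((\<Sum>t = 1..?N. (- 1) ^ t * (?v ^ t * A)) +
      (\<Sum>t = 1..?N. (- 1) ^ t * (?v ^ t * A))) + (- 1) ^ Suc ?N * (?v ^ Suc ?N * (?W * A))"
  proof -
    define S where "S = (\<Sum>t = 1..?N. (- 1) ^ t * ?v ^ t)"
    define Z where "Z = ?v ^ Suc ?N * ?W"
    have "R_quotient (i, j) = 1 + 2 * S + (- 1) ^ Suc ?N * Z"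
      unfolding S_def Z_def by (rule R_quotient_truncate)
    hence "R_quotient (i, j) * A = (1 + 2 * S + (- 1) ^ Suc ?N * Z) * A"
      by (rule arg_cong)
    also have "\<dots> = A + (S * A + S * A) + (- 1) ^ Suc ?N * (Z * A)"
      by (simp only: distrib_right mult_2 mult.assoc mult_1_left)
    finally show ?thesis
      by (simp only: S_def Z_def sum_distrib_right mult.assoc)
  qed
  ultimately show ?thesis
    using ij by (simp only: evaluate_add evaluate_sum evaluate_sign evaluate_mvar_power_times mult_2
        mult_zero_right add_0_right)
qed

section \<open>Pfaffians as values of the kernel\<close>

text \<open>
  This and the next lemma bring the two recursions for Pfaffians to indices starting from \<open>0\<close>, and
  extend them to the lists of length one and two, so that they need not be treated separately below.
\<close>

lemma multi_pf_odd:
  assumes "odd (length ps)"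
  shows "multi_pf ps = (\<Sum>t < length ps. (- 1) ^ t * (case ps ! t of (c, r) \<Rightarrow> c r) * multi_pf (del_nth t ps))"
proof (cases "length ps \<ge> 3")
  case True
  thus ?thesis
    using assms by (simp add: multi_pf_rec sum.atLeast1_atMost_eq)
next
  case False
  hence "length ps = 1" using assms by presburger
  then obtain p where "ps = [p]" by (auto simp: length_Suc_conv)
  thus ?thesis by (cases p) (simp add: del_nth_def)
qed

lemma multi_pf_even:
  assumes "odd (length ps)"
  shows "multi_pf (q # ps) = (\<Sum>t < length ps. (- 1) ^ t * multi_pf [q, ps ! t] * multi_pf (del_nth t ps))"
proof (cases "length ps \<ge> 2")
  case True
  have "multi_pf (q # ps) = (\<Sum>t = 2..Suc (length ps). (- 1) ^ t * multi_pf [q, (q # ps) ! (t - 1)] *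
      multi_pf (tl (del_nth (t - 1) (q # ps))))"
    using assms True by (subst multi_pf_rec) simp_all
  also have "\<dots> = (\<Sum>t < length ps. (- 1) ^ (t + 2) * multi_pf [q, (q # ps) ! (t + 1)] *
      multi_pf (tl (del_nth (t + 1) (q # ps))))"
    by (rule sum.reindex_bij_witness[where i = "\<lambda>t. t - 2" and j = "\<lambda>t. t + 2", symmetric]) auto
  also have "\<dots> = (\<Sum>t < length ps. (- 1) ^ t * multi_pf [q, ps ! t] * multi_pf (del_nth t ps))"
    by (simp add: del_nth_def)
  finally show ?thesis .
next
  case False
  hence "length ps = 1" using assms by presburger
  then obtain p where "ps = [p]" by (auto simp: length_Suc_conv)
  thus ?thesis by (simp add: del_nth_def del: multi_pf.simps(3))
qed

lemma map_del_nth: "map f (del_nth t xs) = del_nth t (map f xs)"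
  by (simp add: del_nth_def take_map drop_map)

lemma del_nth_sorted:
  fixes xs :: "nat list"
  assumes "sorted_wrt (<) xs" "t < length xs"
  shows "sorted_wrt (<) (del_nth t xs)" "set (del_nth t xs) = set xs - {xs ! t}"
    "card {i \<in> set xs. i < xs ! t} = t"
proof -
  define ys x zs where "ys = take t xs" and "x = xs ! t" and "zs = drop (Suc t) xs"
  have xs: "xs = ys @ x # zs"
    unfolding ys_def x_def zs_def by (rule id_take_nth_drop[OF assms(2)])
  have del: "del_nth t xs = ys @ zs"
    by (simp add: del_nth_def ys_def zs_def)
  have S: "sorted_wrt (<) (ys @ x # zs)" using assms(1) xs by simp
  show "sorted_wrt (<) (del_nth t xs)"
    unfolding del using S by (auto simp: sorted_wrt_append)
  show "set (del_nth t xs) = set xs - {xs ! t}"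
    unfolding del x_def[symmetric] using xs S by (auto simp: sorted_wrt_append)
  have "{i \<in> set xs. i < xs ! t} = set ys"
    unfolding x_def[symmetric] using xs S by (auto simp: sorted_wrt_append dest: order.asym)
  moreover have "distinct ys" using S by (simp add: sorted_wrt_append strict_sorted_iff)
  ultimately show "card {i \<in> set xs. i < xs ! t} = t"
    using assms(2) by (simp add: distinct_card ys_def)
qed

lemma sum_set_nth:
  "distinct xs \<Longrightarrow> (\<Sum>x \<in> set xs. g x) = (\<Sum>t < length xs. g (xs ! t))"
  by (rule sum.reindex_bij_betw[symmetric], rule bij_betw_nth) simp_all

definition R_kernel :: "nat set \<Rightarrow> (nat \<times> nat) mfps" where
  "R_kernel S = (\<Prod>p \<in> pairs_in S. R_quotient p)"

lemma mfps_in_R_kernel: "mfps_in (pairs_in S) (R_kernel S)"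
  unfolding R_kernel_def by (intro mfps_in_prod mfps_in_mono[OF mfps_in_R_quotient]) auto

lemma evaluate_R_kernel:
  assumes "S \<subseteq> {..<length s}"
  shows "evaluate c s (A * R_kernel S) = evaluate c s (A * path.kernel_prod S)"
  unfolding R_kernel_def path.kernel_prod_def
  by (rule evaluate_prod_R_quotient) (use assms in \<open>auto simp: pairs_in_def index_pairs_def\<close>)

text \<open>
  Schur's identity holds for the path representation, and both sides may be evaluated in either
  representation.
\<close>

lemma evaluate_kernel_odd:
  assumes xs: "sorted_wrt (<) xs" "set xs \<subseteq> {..<length s}" and odd: "odd (length xs)"
  shows "evaluate c s (R_kernel (set xs)) =
    (\<Sum>t < length xs. (- 1) ^ t * evaluate c s (R_kernel (set (del_nth t xs))))"
proof -
  have dist: "distinct xs" using xs by (simp add: strict_sorted_iff)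
  have "evaluate c s (R_kernel (set xs)) = evaluate c s (path.kernel_prod (set xs))"
    using evaluate_R_kernel[OF xs(2), of c 1] by simp
  also have "path.kernel_prod (set xs) = (\<Sum>t < length xs. (- 1) ^ t * path.kernel_prod (set (del_nth t xs)))"
    using odd dist xs by (simp add: path.schur_odd distinct_card sum_set_nth del_nth_sorted)
  also have "evaluate c s \<dots> = (\<Sum>t < length xs. (- 1) ^ t * evaluate c s (R_kernel (set (del_nth t xs))))"
    unfolding evaluate_sum evaluate_sign
  proof (intro sum.cong refl arg_cong2[where f = "(*)"])
    fix t assume "t \<in> {..<length xs}"
    hence "set (del_nth t xs) \<subseteq> {..<length s}" using xs by (auto simp: del_nth_sorted)
    from evaluate_R_kernel[OF this, of c 1]
    show "evaluate c s (path.kernel_prod (set (del_nth t xs))) = evaluate c s (R_kernel (set (del_nth t xs)))"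
      by simp
  qed
  finally show ?thesis .
qed

lemma evaluate_kernel_even:
  assumes xs: "sorted_wrt (<) (a # xs)" "set (a # xs) \<subseteq> {..<length s}" and odd: "odd (length xs)"
  shows "evaluate c s (R_kernel (set (a # xs))) =
    (\<Sum>t < length xs. (- 1) ^ t * evaluate c s (R_quotient (a, xs ! t) * R_kernel (set (del_nth t xs))))"
proof -
  have dist: "distinct xs" and sorted: "sorted_wrt (<) xs" using xs by (simp_all add: strict_sorted_iff)
  have "evaluate c s (R_kernel (set (a # xs))) = evaluate c s (path.kernel_prod (insert a (set xs)))"
    using evaluate_R_kernel[OF xs(2), of c 1] by simp
  also have "path.kernel_prod (insert a (set xs)) =
      (\<Sum>t < length xs. (- 1) ^ t * (path_quotient a (xs ! t) * path.kernel_prod (set (del_nth t xs))))"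
    using odd dist xs sorted by (subst path.schur_even) (simp_all add: distinct_card sum_set_nth del_nth_sorted)
  also have "evaluate c s \<dots> =
      (\<Sum>t < length xs. (- 1) ^ t * evaluate c s (R_quotient (a, xs ! t) * R_kernel (set (del_nth t xs))))"
    unfolding evaluate_sum evaluate_sign
  proof (intro sum.cong refl arg_cong2[where f = "(*)"])
    fix t assume t: "t \<in> {..<length xs}"
    hence "set (del_nth t xs) \<subseteq> {..<length s}" using xs sorted by (auto simp: del_nth_sorted)
    note evaluate_R_kernel[OF this, symmetric, of c "path_quotient a (xs ! t)"]
    also have "evaluate c s (path_quotient a (xs ! t) * R_kernel (set (del_nth t xs))) =
        evaluate c s (R_quotient (a, xs ! t) * R_kernel (set (del_nth t xs)))"
      by (rule evaluate_R_quotient[symmetric]) (use t xs in \<open>auto simp: index_pairs_def subset_iff\<close>)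
    finally show "evaluate c s (path_quotient a (xs ! t) * path.kernel_prod (set (del_nth t xs))) =
        evaluate c s (R_quotient (a, xs ! t) * R_kernel (set (del_nth t xs)))" .
  qed
  finally show ?thesis .
qed

definition product_outside :: "(nat \<Rightarrow> int \<Rightarrow> 'a :: comm_ring_1) \<Rightarrow> int list \<Rightarrow> nat set \<Rightarrow> 'a" where
  "product_outside c s S = (\<Prod>l \<in> {..<length s} - S. c l (s ! l))"

lemma product_outside_insert:
  assumes "i < length s" "i \<notin> S"
  shows "product_outside c s S = c i (s ! i) * product_outside c s (insert i S)"
proof -
  have split: "{..<length s} - S = insert i ({..<length s} - insert i S)" using assms by auto
  show ?thesis unfolding product_outside_def by (subst split, rule prod.insert) auto
qed

text \<open>
  The recursion for Pfaffians of even length multiplies by a Pfaffian of length two. Each term of the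
  latter is a product of two entries at shifted subscripts \<open>i\<close> and \<open>j\<close>; as \<open>A\<close> does not involve these
  positions, its value changes by exactly these factors.
\<close>

lemma evaluate_pair_step:
  assumes neg: "\<And>i r. r < 0 \<Longrightarrow> c i r = 0" and ij: "i < j" "j < length s" "i \<notin> S" "j \<notin> S"
    and A: "mfps_in (pairs_in S) A"
    and M: "\<And>s'. length s' = length s \<Longrightarrow> (\<And>l. l \<in> S \<Longrightarrow> s' ! l = s ! l) \<Longrightarrow>
      evaluate c s' A = M * product_outside c s' S"
  shows "evaluate c s (R_quotient (i, j) * A) =
    multi_pf [(c i, s ! i), (c j, s ! j)] * (M * product_outside c s (insert j (insert i S)))"
proof -
  let ?P = "product_outside c s (insert j (insert i S))"
  let ?s = "\<lambda>t. s[i := s ! i + int t, j := s ! j - int t]"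
  have shift: "evaluate c (?s t) A = c i (s ! i + int t) * c j (s ! j - int t) * (M * ?P)" for t
  proof -
    have "evaluate c (?s t) A = M * product_outside c (?s t) S"
      by (rule M) (use ij in \<open>auto simp: nth_list_update\<close>)
    also have "product_outside c (?s t) S =
        c i (?s t ! i) * (c j (?s t ! j) * product_outside c (?s t) (insert j (insert i S)))"
      using ij by (simp add: product_outside_insert[of i _ S] product_outside_insert[of j _ "insert i S"])
    also have "product_outside c (?s t) (insert j (insert i S)) = ?P"
      unfolding product_outside_def by (rule prod.cong) auto
    finally show ?thesis
      using ij by (simp add: ac_simps)
  qed
  have j: "(j, k) \<notin> pairs_in S" for k
    using ij by (simp add: pairs_in_def)
  have "evaluate c s (R_quotient (i, j) * A) = evaluate c s A +
      2 * (\<Sum>t = 1..nat (s ! j). (- 1) ^ t * evaluate c (?s t) A)"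
    by (rule evaluate_R_quotient_expand[OF _ ij(1,2) A j]) (rule neg)
  also have "\<dots> = evaluate c (?s 0) A + 2 * (\<Sum>t = 1..nat (s ! j). (- 1) ^ t * evaluate c (?s t) A)"
    by simp
  also have "\<dots> = (c i (s ! i + int 0) * c j (s ! j - int 0) +
      2 * (\<Sum>t = 1..nat (s ! j). (- 1) ^ t * c i (s ! i + int t) * c j (s ! j - int t))) * (M * ?P)"
    unfolding shift by (simp only: distrib_right sum_distrib_right mult.assoc)
  finally show ?thesis
    by (simp only: multi_pf.simps of_nat_0 add_0_right diff_zero)
qed

text \<open>
  The kernel is restricted to a subset of the positions, while the entries at the other positions
  remain as factors. In this form no product of two values is needed in the induction: removing a
  position from the kernel moves its entry to the product outside.
\<close>

lemma evaluate_R_kernel_eq_multi_pf: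
  assumes neg: "\<And>i r. r < 0 \<Longrightarrow> c i r = 0"
    and "sorted_wrt (<) xs" "set xs \<subseteq> {..<length s}"
  shows "evaluate c s (R_kernel (set xs)) =
    multi_pf (map (\<lambda>i. (c i, s ! i)) xs) * product_outside c s (set xs)"
  using assms(2,3)
proof (induction "length xs" arbitrary: xs s rule: less_induct)
  case less
  define f where "f = (\<lambda>s i. (c i, s ! i :: int))"
  have "xs = [] \<or> odd (length xs) \<or> (\<exists>a ys. xs = a # ys \<and> odd (length ys))"
    by (cases xs) simp_all
  then consider (Nil) "xs = []" | (odd) "odd (length xs)" | (even) a ys where "xs = a # ys" "odd (length ys)"
    by blast
  thus ?case
  proof cases
    case Nil
    thus ?thesis
      by (simp add: R_kernel_def pairs_in_def evaluate_one[OF neg] product_outside_def monomial_value_def lessThan_def)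
  next
    case odd
    let ?g = "\<lambda>t. c (xs ! t) (s ! (xs ! t)) * multi_pf (map (f s) (del_nth t xs)) * product_outside c s (set xs)"
    have "evaluate c s (R_kernel (set xs)) = (\<Sum>t < length xs. (- 1) ^ t * ?g t)"
      unfolding evaluate_kernel_odd[OF less.prems odd]
    proof (intro sum.cong refl arg_cong2[where f = "(*)"])
      fix t assume t: "t \<in> {..<length xs}"
      hence D: "sorted_wrt (<) (del_nth t xs)" "set (del_nth t xs) = set xs - {xs ! t}"
        using less.prems by (simp_all add: del_nth_sorted)
      have "evaluate c s (R_kernel (set (del_nth t xs))) =
          multi_pf (map (f s) (del_nth t xs)) * product_outside c s (set (del_nth t xs))"
        unfolding f_def using t D less.prems by (intro less.hyps) (auto simp: length_del_nth)
      also have "product_outside c s (set (del_nth t xs)) = c (xs ! t) (s ! (xs ! t)) * product_outside c s (set xs)"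
        using t less.prems D
        by (subst product_outside_insert[of "xs ! t"]) (auto simp: insert_absorb subset_iff)
      finally show "evaluate c s (R_kernel (set (del_nth t xs))) = ?g t"
        by (simp add: ac_simps)
    qed
    also have "\<dots> = multi_pf (map (f s) xs) * product_outside c s (set xs)"
      using odd by (simp add: multi_pf_odd map_del_nth f_def) (simp add: sum_distrib_left sum_distrib_right ac_simps)
    finally show ?thesis by (simp add: f_def)
  next
    case (even a ys)
    let ?g = "\<lambda>t. multi_pf [f s a, f s (ys ! t)] *
      (multi_pf (map (f s) (del_nth t ys)) * product_outside c s (set xs))"
    have sorted: "sorted_wrt (<) ys" and above: "\<And>y. y \<in> set ys \<Longrightarrow> a < y"
      using less.prems(1) unfolding even(1) by simp_all
    have "evaluate c s (R_kernel (set xs)) =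
        (\<Sum>t < length ys. (- 1) ^ t * evaluate c s (R_quotient (a, ys ! t) * R_kernel (set (del_nth t ys))))"
      using evaluate_kernel_even[OF less.prems[unfolded even(1)] even(2), of c] unfolding even(1) .
    also have "\<dots> = (\<Sum>t < length ys. (- 1) ^ t * ?g t)"
    proof (intro sum.cong refl arg_cong2[where f = "(*)"])
      fix t assume "t \<in> {..<length ys}"
      hence t: "t < length ys" by simp
      let ?zs = "del_nth t ys"
      have D: "sorted_wrt (<) ?zs" "set ?zs = set ys - {ys ! t}"
        using sorted t by (simp_all add: del_nth_sorted)
      have union: "insert (ys ! t) (insert a (set ?zs)) = set xs"
        unfolding D(2) even(1) list.set(2) using t by (simp add: insert_commute insert_absorb)
      have "evaluate c s (R_quotient (a, ys ! t) * R_kernel (set ?zs)) =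
          multi_pf [(c a, s ! a), (c (ys ! t), s ! (ys ! t))] *
          (multi_pf (map (f s) ?zs) * product_outside c s (insert (ys ! t) (insert a (set ?zs))))"
      proof (rule evaluate_pair_step[OF neg _ _ _ _ mfps_in_R_kernel])
        show "a < ys ! t" using above t by simp
        show "ys ! t < length s" using less.prems even(1) t by (auto simp: subset_iff)
        show "a \<notin> set ?zs" "ys ! t \<notin> set ?zs" using above D(2) by auto
        fix s' :: "int list"
        assume s': "length s' = length s" "\<And>l. l \<in> set ?zs \<Longrightarrow> s' ! l = s ! l"
        have "evaluate c s' (R_kernel (set ?zs)) = multi_pf (map (f s') ?zs) * product_outside c s' (set ?zs)"
          unfolding f_def using t D less.prems even(1) s' by (intro less.hyps) (auto simp: length_del_nth)
        also have "map (f s') ?zs = map (f s) ?zs"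
          using s'(2) by (simp add: f_def)
        finally show "evaluate c s' (R_kernel (set ?zs)) = multi_pf (map (f s) ?zs) * product_outside c s' (set ?zs)" .
      qed
      thus "evaluate c s (R_quotient (a, ys ! t) * R_kernel (set ?zs)) = ?g t"
        unfolding union by (simp only: f_def)
    qed
    also have "\<dots> = multi_pf (map (f s) xs) * product_outside c s (set xs)"
    proof -
      have "multi_pf (map (f s) xs) = (\<Sum>t < length ys.
          (- 1) ^ t * multi_pf [f s a, f s (ys ! t)] * multi_pf (map (f s) (del_nth t ys)))"
        using multi_pf_even[of "map (f s) ys" "f s a"] even
        by (simp add: map_del_nth del: multi_pf.simps)
      thus ?thesis
        by (simp only: sum_distrib_right mult.assoc)
    qed
    finally show ?thesis by (simp add: f_def)
  qed
qed

section \<open>Summation over the subsets of the index set\<close>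

text \<open>
  The exponent of the monomial \<open>\<Prod>p \<in> I. mvar p\<close>.
\<close>

definition set_exponent :: "'v set \<Rightarrow> 'v \<Rightarrow>\<^sub>0 nat" where
  "set_exponent I = (\<Sum>p \<in> I. Poly_Mapping.single p 1)"

lemma lookup_set_exponent:
  "finite I \<Longrightarrow> Poly_Mapping.lookup (set_exponent I) p = (if p \<in> I then 1 else 0)"
  unfolding set_exponent_def by (induction I rule: finite_induct) (auto simp: lookup_add lookup_single when_def)

lemma raise_set_exponent:
  assumes "I \<subseteq> index_pairs (length s)" "i < length s"
  shows "raise (set_exponent I) s ! i = s ! i + a_shift I i"
proof -
  have "finite I" using assms(1) finite_index_pairs by (rule finite_subset)
  note L = lookup_set_exponent[OF this]
  have "{j. (i, j) \<in> I} = {j \<in> {..<length s}. (i, j) \<in> I}" "{j. (j, i) \<in> I} = {j \<in> {..<length s}. (j, i) \<in> I}"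
    using assms(1) by (auto simp: index_pairs_def)
  hence "(\<Sum>j < length s. int (Poly_Mapping.lookup (set_exponent I) (i, j))) = int (card {j. (i, j) \<in> I})"
    "(\<Sum>j < length s. int (Poly_Mapping.lookup (set_exponent I) (j, i))) = int (card {j. (j, i) \<in> I})"
    by (simp_all add: L if_distrib sum.If_cases Int_def)
  thus ?thesis
    using assms(2) by (simp add: raise_def a_shift_def)
qed

lemma evaluate_raise_set_exponent:
  assumes "I \<subseteq> index_pairs (length s)"
  shows "evaluate c (raise (set_exponent I) s) Q = evaluate c s ((\<Prod>p \<in> I. mvar p) * Q)"
proof -
  have "finite I" using assms finite_index_pairs by (rule finite_subset)
  thus ?thesis using assms
  proof (induction I arbitrary: Q rule: finite_induct)
    case empty
    show ?case by (simp add: set_exponent_def raise_zero)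
  next
    case (insert p I)
    have "set_exponent (insert p I) = Poly_Mapping.single p 1 + set_exponent I"
      unfolding set_exponent_def using insert.hyps by simp
    hence "evaluate c (raise (set_exponent (insert p I)) s) Q = evaluate c (raise (set_exponent I) s) (mvar p * Q)"
      using insert.prems by (simp only: raise_add) (subst evaluate_mvar_times, simp_all)
    thus ?case
      using insert by (simp add: ac_simps)
  qed
qed

lemma evaluate_subset_sum:
  assumes "D \<subseteq> index_pairs (length s)"
  shows "(\<Sum>I \<in> Pow D. evaluate c (raise (set_exponent I) s) Q) = evaluate c s ((\<Prod>p \<in> D. 1 + mvar p) * Q)"
proof -
  have "finite D" using assms finite_index_pairs by (rule finite_subset)
  hence "(\<Prod>p \<in> D. 1 + mvar p) = (\<Sum>I \<in> Pow D. \<Prod>p \<in> I. mvar p)"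
    using prod_add[of D mvar "\<lambda>_. 1"] by (simp add: add.commute)
  hence "evaluate c s ((\<Prod>p \<in> D. 1 + mvar p) * Q) = (\<Sum>I \<in> Pow D. evaluate c s ((\<Prod>p \<in> I. mvar p) * Q))"
    by (simp only: sum_distrib_right evaluate_sum)
  also have "\<dots> = (\<Sum>I \<in> Pow D. evaluate c (raise (set_exponent I) s) Q)"
    using assms by (intro sum.cong refl evaluate_raise_set_exponent[symmetric]) auto
  finally show ?thesis ..
qed

lemma R_operator_eq:
  assumes "D \<subseteq> index_pairs m"
  shows "R_operator m D = (\<Prod>p \<in> D. 1 + mvar p) * R_kernel {..<m}"
proof -
  have "pairs_in {..<m} = index_pairs m"
    by (auto simp: pairs_in_def index_pairs_def)
  hence "R_kernel {..<m} = (\<Prod>p \<in> index_pairs m - D. R_quotient p) * (\<Prod>p \<in> D. R_quotient p)"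
    unfolding R_kernel_def using prod.subset_diff[OF assms finite_index_pairs] by simp
  moreover have "(\<Prod>p \<in> D. 1 - mvar p) = (\<Prod>p \<in> D. 1 + mvar p) * (\<Prod>p \<in> D. R_quotient p)"
    by (simp add: prod.distrib[symmetric] R_quotient_eq)
  ultimately show ?thesis
    by (simp add: R_operator_def ac_simps)
qed

text \<open>
  The identity for an arbitrary set \<open>D\<close> of pairs: summation over \<open>I\<close> multiplies the kernel by
  \<open>\<Prod>p \<in> D. 1 + mvar p\<close>, which gives the operator \<open>R_operator\<close>.
\<close>

theorem sum_multi_pf_eq_substitute_R_operator:
  assumes neg: "\<And>i r. r < 0 \<Longrightarrow> c i r = 0" and D: "D \<subseteq> index_pairs (length s)"
  shows "(\<Sum>I \<in> Pow D. multi_pf (map (\<lambda>i. (c i, s ! i + a_shift I i)) [0..<length s])) =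
    substitute c (apply_series (R_operator (length s) D) s)"
proof -
  let ?m = "length s"
  have "multi_pf (map (\<lambda>i. (c i, s ! i + a_shift I i)) [0..<?m]) =
      evaluate c (raise (set_exponent I) s) (R_kernel {..<?m})" if "I \<in> Pow D" for I
  proof -
    have I: "I \<subseteq> index_pairs ?m" using that D by auto
    have "evaluate c (raise (set_exponent I) s) (R_kernel (set [0..<?m])) =
        multi_pf (map (\<lambda>i. (c i, raise (set_exponent I) s ! i)) [0..<?m]) *
        product_outside c (raise (set_exponent I) s) (set [0..<?m])"
      by (rule evaluate_R_kernel_eq_multi_pf[OF neg]) auto
    moreover have "map (\<lambda>i. (c i, raise (set_exponent I) s ! i)) [0..<?m] =
        map (\<lambda>i. (c i, s ! i + a_shift I i)) [0..<?m]"
      using raise_set_exponent[OF I] by simp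
    ultimately show ?thesis
      by (simp add: product_outside_def atLeast0LessThan)
  qed
  hence "(\<Sum>I \<in> Pow D. multi_pf (map (\<lambda>i. (c i, s ! i + a_shift I i)) [0..<?m])) =
      evaluate c s (R_operator ?m D)"
    by (simp only: evaluate_subset_sum[OF D] R_operator_eq[OF D] cong: sum.cong)
  also have "\<dots> = substitute c (apply_series (R_operator ?m D) s)"
    by (rule evaluate_eq_substitute[OF neg mfps_in_R_operator[OF D], symmetric])
  finally show ?thesis .
qed

theorem proposition7p6:
  fixes n k :: nat and lam :: "nat list"
  assumes "k \<le> n" and "1 \<le> n" and "lam \<in> kstrict_partitions n k"
  shows "(\<Sum>I \<in> Pow (D_set n k lam).
            multi_pf (map (\<lambda>s. (theta k (chi n k lam ! s), int (lam ! s) + a_shift I s)) [0..<n - k]))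
         = R_theta n k lam"
proof -
  have len: "length (map int lam) = n - k"
    using assms(3) by (simp add: kstrict_partitions_def)
  have D: "D_set n k lam \<subseteq> index_pairs (length (map int lam))"
    unfolding len by (auto simp: D_set_def)
  have "(\<Sum>I \<in> Pow (D_set n k lam).
      multi_pf (map (\<lambda>s. (theta k (chi n k lam ! s), map int lam ! s + a_shift I s)) [0..<length (map int lam)]))
      = R_theta n k lam"
    unfolding R_theta_def len[symmetric]
    by (rule sum_multi_pf_eq_substitute_R_operator[OF _ D]) (simp add: theta_def)
  moreover have "map (\<lambda>s. (theta k (chi n k lam ! s), map int lam ! s + a_shift I s)) [0..<length (map int lam)] =
      map (\<lambda>s. (theta k (chi n k lam ! s), int (lam ! s) + a_shift I s)) [0..<n - k]" for I
    using len by simp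
  ultimately show ?thesis by simp
qed

end
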